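(* Let $r \geq 4$ be an integer, and let $X$ and $Y$ be edge-subgraphs of the complete bipartite graph $K_{r,r}$ such that $$\delta(X) + \delta(Y) \geq \lfloor 3r/2 \rfloor + 1.$$ Then the friends-and-strangers graph $\mathsf{FS}(X,Y)$ has exactly two connected components.
   Context: All graphs are simple. $K_{r,r}$ is the complete bipartite graph whose two partite sets both have size $r$. An edge-subgraph of a graph $G$ is a graph with the same vertex set as $G$ whose edge set is a subset of $E(G)$. $\delta(G)$ denotes the minimum degree of $G$. For simple graphs $X$ and $Y$ on $n$ vertices each, the friends-and-strangers graph $\mathsf{FS}(X,Y)$ is the graph whose vertices are all bijections $V(X) \to V(Y)$, in which two bijections $\sigma, \tau$ are adjacent if and only if there is an edge $\{a,b\} \in E(X)$ such that $\{\sigma(a),\sigma(b)\} \in E(Y)$, $\sigma(a)=\tau(b)$, $\sigma(b)=\tau(a)$, and $\sigma(c)=\tau(c)$ for all $c \in V(X)\setminus\{a,b\}$. *)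

theory Defs
  imports "Graph_Theory.Graph_Theory"
begin

text \<open>
  A simple graph is a finite, symmetric and loop-free set of ordered pairs over a vertex set
  (\<^locale>\<open>pair_graph\<close>): the undirected edge \<open>{a, b}\<close> is the pair of arcs \<open>(a, b)\<close>, \<open>(b, a)\<close>.
\<close>

text \<open>The library notion of a subgraph does not force symmetry, so it is required separately.\<close>

definition edge_subgraph :: "'a pair_pre_digraph \<Rightarrow> 'a pair_pre_digraph \<Rightarrow> bool" where
  "edge_subgraph H G \<longleftrightarrow> pair_graph H \<and> spanning (with_proj H) (with_proj G)"

text \<open>
  By symmetry, the out-degree is the number of neighbours.  The value is unspecified for the graph
  without vertices.
\<close>

definition min_degree :: "'a pair_pre_digraph \<Rightarrow> nat" where
  "min_degree G = Min (out_degree (with_proj G) ` pverts G)"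

text \<open>
  Bijections are represented by functions that are \<^const>\<open>undefined\<close> outside the vertex set of
  \<open>X\<close>, so that each bijection between the vertex sets is exactly one vertex.
\<close>

definition FS :: "'a pair_pre_digraph \<Rightarrow> 'b pair_pre_digraph \<Rightarrow> ('a \<Rightarrow> 'b) pair_pre_digraph" where
  "FS X Y = (let B = {\<sigma> \<in> extensional (pverts X). bij_betw \<sigma> (pverts X) (pverts Y)} in
    \<lparr> pverts = B,
      parcs = {(\<sigma>, \<tau>). \<sigma> \<in> B \<and> \<tau> \<in> B \<and>
        (\<exists>a b. (a, b) \<in> parcs X \<and> (\<sigma> a, \<sigma> b) \<in> parcs Y \<and>
          \<sigma> a = \<tau> b \<and> \<sigma> b = \<tau> a \<and> (\<forall>c \<in> pverts X - {a, b}. \<sigma> c = \<tau> c))} \<rparr>)"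

definition connected_components :: "'a pair_pre_digraph \<Rightarrow> ('a, 'a \<times> 'a) pre_digraph set" where
  "connected_components G = {H. pre_digraph.max_subgraph (with_proj G) connected H}"

lemma pair_graph_FS:
  assumes "pair_graph X" "pair_graph Y"
  shows "pair_graph (FS X Y)"
proof -
  interpret X: pair_graph X by fact
  interpret Y: pair_graph Y by fact
  let ?B = "{\<sigma> \<in> extensional (pverts X). bij_betw \<sigma> (pverts X) (pverts Y)}"
  have "?B \<subseteq> pverts X \<rightarrow>\<^sub>E pverts Y"
    by (auto simp: PiE_def bij_betw_def)
  moreover have "finite (pverts X \<rightarrow>\<^sub>E pverts Y)"
    by (intro finite_PiE X.pair_finite_verts Y.pair_finite_verts)
  ultimately have fin: "finite ?B"
    by (rule finite_subset)
  have arcs: "parcs (FS X Y) \<subseteq> ?B \<times> ?B"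
    by (auto simp: FS_def Let_def)
  show ?thesis
  proof
    show "finite (pverts (FS X Y))"
      using fin by (simp add: FS_def Let_def)
    show "finite (parcs (FS X Y))"
      using arcs fin by (meson finite_SigmaI finite_subset)
    show "symmetric (with_proj (FS X Y))"
      unfolding symmetric_def with_proj_simps
    proof (rule symI)
      fix \<sigma> \<tau> assume "(\<sigma>, \<tau>) \<in> parcs (FS X Y)"
      then obtain a b where B: "\<sigma> \<in> ?B" "\<tau> \<in> ?B"
        and ab: "(a, b) \<in> parcs X" "(\<sigma> a, \<sigma> b) \<in> parcs Y" "\<sigma> a = \<tau> b" "\<sigma> b = \<tau> a"
          "\<forall>c \<in> pverts X - {a, b}. \<sigma> c = \<tau> c"
        by (auto simp: FS_def Let_def)
      have "(\<sigma> b, \<sigma> a) \<in> parcs Y"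
        using ab(2) Y.graph_symmetric by simp
      with ab have "(a, b) \<in> parcs X \<and> (\<tau> a, \<tau> b) \<in> parcs Y \<and> \<tau> a = \<sigma> b \<and> \<tau> b = \<sigma> a \<and>
          (\<forall>c \<in> pverts X - {a, b}. \<tau> c = \<sigma> c)"
        by auto
      with B show "(\<tau>, \<sigma>) \<in> parcs (FS X Y)"
        unfolding FS_def Let_def by (simp, blast)
    qed
  next
    fix e assume e: "e \<in> parcs (FS X Y)"
    show "fst e \<in> pverts (FS X Y)" "snd e \<in> pverts (FS X Y)"
      using e by (auto simp: FS_def Let_def)
    show "fst e \<noteq> snd e"
    proof
      assume eq: "fst e = snd e"
      from e obtain a b where "(a, b) \<in> parcs X" and "(fst e a, fst e b) \<in> parcs Y"
        and "fst e a = snd e b"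
        by (auto simp: FS_def Let_def)
      with eq Y.pair_no_loops[of "(fst e a, fst e b)"] show False by simp
    qed
  qed
qed

lemma connected_components_eq_sccs:
  assumes "pair_graph G"
  shows "connected_components G = pre_digraph.sccs (with_proj G)"
proof -
  let ?G = "with_proj G"
  have "graph ?G"
  proof -
    interpret pair_graph G by fact
    show ?thesis by unfold_locales
  qed
  then interpret wG: graph ?G .
  have sub: "subgraph (?G \<restriction> verts H) ?G" "subgraph H (?G \<restriction> verts H)"
    if "subgraph H ?G" for H
    using that wG.subgraph_induce_subgraphI[of "verts H"] subgraph_induce_subgraphI2[of H ?G]
    by (simp_all add: subgraph_def)
  have sc: "strongly_connected (?G \<restriction> verts H)" if H: "subgraph H ?G" and c: "connected H" for H
  proof -
    interpret I: wf_digraph "?G \<restriction> verts H"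
      using sub(1)[OF H] by (simp add: subgraph_def)
    have "spanning H (?G \<restriction> verts H)"
      using sub(2)[OF H] by (simp add: spanning_def)
    then have "connected (?G \<restriction> verts H)"
      using c by (rule I.connected_spanning_imp_connected)
    moreover have "symmetric (?G \<restriction> verts H)"
    proof (rule induced_graph_imp_symmetric[OF wG.sym_arcs wG.induced_induce])
      show "verts H \<subseteq> verts ?G"
        using H by (simp add: subgraph_def)
    qed
    ultimately show ?thesis
      by (rule I.symmetric_connected_imp_strongly_connected[rotated])
  qed
  have conn: "connected H" if "strongly_connected H" for H :: "('a, 'a \<times> 'a) pre_digraph"
  proof -
    have "arcs_ends H \<subseteq> (arcs_ends H)\<^sup>s"
      by (auto simp: symcl_def)
    then show ?thesis
      using that rtrancl_on_mono[OF _ order_refl, of "arcs_ends H" "(arcs_ends H)\<^sup>s"]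
      unfolding connected_conv strongly_connected_def reachable_def by meson
  qed
  have max: "pre_digraph.max_subgraph ?G P H \<longleftrightarrow>
      subgraph H ?G \<and> P H \<and> (\<forall>H'. subgraph H H' \<longrightarrow> subgraph H' ?G \<longrightarrow> P H' \<longrightarrow> H' = H)" for P H
    unfolding pre_digraph.max_subgraph_def by metis
  have "pre_digraph.max_subgraph ?G connected H
      \<longleftrightarrow> pre_digraph.max_subgraph ?G strongly_connected H" for H
  proof
    assume m: "pre_digraph.max_subgraph ?G connected H"
    then have H: "subgraph H ?G" "connected H"
      and eq: "\<And>H'. subgraph H H' \<Longrightarrow> subgraph H' ?G \<Longrightarrow> connected H' \<Longrightarrow> H' = H"
      unfolding max by simp_all
    have "?G \<restriction> verts H = H"
      by (rule eq[OF sub(2)[OF H(1)] sub(1)[OF H(1)] conn[OF sc[OF H]]])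
    then have "strongly_connected H"
      using sc[OF H] by simp
    with H(1) eq conn show "pre_digraph.max_subgraph ?G strongly_connected H"
      unfolding max by metis
  next
    assume m: "pre_digraph.max_subgraph ?G strongly_connected H"
    then have H: "subgraph H ?G" "strongly_connected H"
      and eq: "\<And>H'. subgraph H H' \<Longrightarrow> subgraph H' ?G \<Longrightarrow> strongly_connected H' \<Longrightarrow> H' = H"
      unfolding max by simp_all
    have "H' = H" if H': "subgraph H H'" "subgraph H' ?G" "connected H'" for H'
    proof -
      have "?G \<restriction> verts H' = H"
        by (rule eq[OF subgraph_trans[OF H'(1) sub(2)[OF H'(2)]] sub(1)[OF H'(2)] sc[OF H'(2,3)]])
      then have "subgraph H' H"
        using sub(2)[OF H'(2)] by simp
      with H'(1) have "verts H' = verts H" "arcs H' = arcs H" "tail H' = tail H" "head H' = head H"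
        by (simp_all add: subgraph_def compatible_def set_eq_subset)
      then show ?thesis
        by (intro pre_digraph.equality) simp_all
    qed
    with H(1) conn[OF H(2)] show "pre_digraph.max_subgraph ?G connected H"
      unfolding max by metis
  qed
  then show ?thesis
    unfolding connected_components_def pre_digraph.sccs_altdef2 by (intro set_eqI) simp
qed

end

theory Submission
  imports Defs "HOL-Combinatorics.Permutations"
begin

text \<open>
  Let $A$, $B$ be the two parts.  Each vertex misses at most $r - \delta(X)$ positions in $X$ and
  $r - \delta(Y)$ people in $Y$, together at most $m = \lfloor (r-1)/2 \rfloor$.  The key claim is that
  whenever adjacent positions $a \in A$, $b \in B$ hold people $u$, $v$ from different parts, the
  configuration with $u$ and $v$ exchanged is reachable, even if $u$ and $v$ are not friends.  Then $Y$
  may be replaced by $K_{r,r}$ and, passing to inverse bijections, so may $X$.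

  For the claim, move the other people until everybody is on the side of $u$ and $v$ prescribed by
  their part, and conjugate.  In that position counting yields either a $K_{3,2}$ around $a$, $b$ that
  realises the exchange, or $r = 2m + 1$ and the common edges between the neighbours of $a$ and $b$ form
  a perfect matching; then all counts are tight, each missing common edge is missing in only one of the
  two graphs, and an explicit sequence of swaps on eight positions does it.  If the straightening
  gets stuck, the counts are tight as well and a similar sequence on at most seven positions applies.

  For $K_{r,r}$ itself, the sign of the bijection times the parity of the number of people of $A$ in
  $A$ is the only invariant.
\<close>

section \<open>Swaps\<close>

text \<open>Configurations are total functions here, so a swap is composition with a transposition
  and the library on permutations applies. \<open>X\<close> and \<open>Y\<close> enter as bare
  relations, so that either can later be replaced by a complete bipartite graph and the two can
  change roles.\<close>

definition swap_step :: "('a \<Rightarrow> 'a \<Rightarrow> bool) \<Rightarrow> ('b \<Rightarrow> 'b \<Rightarrow> bool) \<Rightarrow> ('a \<Rightarrow> 'b) \<Rightarrow> ('a \<Rightarrow> 'b) \<Rightarrow> bool" where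
  "swap_step X Y \<sigma> \<tau> \<longleftrightarrow> (\<exists>a b. X a b \<and> Y (\<sigma> a) (\<sigma> b) \<and> \<tau> = \<sigma> \<circ> transpose a b)"

abbreviation reach :: "('a \<Rightarrow> 'a \<Rightarrow> bool) \<Rightarrow> ('b \<Rightarrow> 'b \<Rightarrow> bool) \<Rightarrow> ('a \<Rightarrow> 'b) \<Rightarrow> ('a \<Rightarrow> 'b) \<Rightarrow> bool" where
  "reach X Y \<equiv> (swap_step X Y)\<^sup>*\<^sup>*"

lemma swap_stepI: "X a b \<Longrightarrow> Y (\<sigma> a) (\<sigma> b) \<Longrightarrow> swap_step X Y \<sigma> (\<sigma> \<circ> transpose a b)"
  unfolding swap_step_def by blast

lemma reachI: "X a b \<Longrightarrow> Y (\<sigma> a) (\<sigma> b) \<Longrightarrow> reach X Y \<sigma> (\<sigma> \<circ> transpose a b)"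
  by (intro r_into_rtranclp swap_stepI)

lemma swap_step_sym:
  assumes "symp Y" "swap_step X Y \<sigma> \<tau>"
  shows "swap_step X Y \<tau> \<sigma>"
proof -
  from assms(2) obtain a b where *: "X a b" "Y (\<sigma> a) (\<sigma> b)" "\<tau> = \<sigma> \<circ> transpose a b"
    unfolding swap_step_def by blast
  have "\<sigma> = \<tau> \<circ> transpose a b" by (simp add: *(3) comp_assoc)
  moreover have "Y (\<tau> a) (\<tau> b)" using *(2) assms(1) by (simp add: *(3) sympD)
  ultimately show ?thesis using *(1) unfolding swap_step_def by blast
qed

lemma reach_sym: "symp Y \<Longrightarrow> reach X Y \<sigma> \<tau> \<Longrightarrow> reach X Y \<tau> \<sigma>"
  by (metis swap_step_sym sympI symp_rtranclp sympD)

lemma reach_mono: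
  assumes "reach X Y \<sigma> \<tau>" "\<And>a b. X a b \<Longrightarrow> X' a b" "\<And>a b. Y a b \<Longrightarrow> Y' a b"
  shows "reach X' Y' \<sigma> \<tau>"
  using assms(1)
proof (rule rtranclp_mono[THEN predicate2D, rotated])
  show "swap_step X Y \<le> swap_step X' Y'" using assms(2,3) unfolding swap_step_def by blast
qed

text \<open>Swaps away from \<open>a\<close> and \<open>b\<close> commute with
  \<open>transpose a b\<close>. So one walks from \<open>\<sigma>\<close> to \<open>\<tau>\<close>,
  exchanges there, and runs the same swaps backwards.\<close>

lemma reach_conjugate:
  assumes sym: "symp Y"
    and "reach (\<lambda>x y. X x y \<and> x \<notin> {a, b} \<and> y \<notin> {a, b}) Y \<sigma> \<tau>"
    and "reach X Y \<tau> (\<tau> \<circ> transpose a b)"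
  shows "reach X Y \<sigma> (\<sigma> \<circ> transpose a b)"
  using assms(2,3)
proof (induction rule: converse_rtranclp_induct)
  case base then show ?case .
next
  case (step \<sigma> \<sigma>')
  then obtain c d where cd: "X c d" "Y (\<sigma> c) (\<sigma> d)" "\<sigma>' = \<sigma> \<circ> transpose c d"
    "c \<notin> {a, b}" "d \<notin> {a, b}"
    unfolding swap_step_def by blast
  have "transpose c d \<circ> transpose a b = transpose a b \<circ> transpose c d"
    using cd(4,5) by (auto simp: fun_eq_iff transpose_def)
  then have eq: "\<sigma>' \<circ> transpose a b = (\<sigma> \<circ> transpose a b) \<circ> transpose c d"
    by (simp add: cd(3) comp_assoc)
  have "swap_step X Y (\<sigma> \<circ> transpose a b) (\<sigma>' \<circ> transpose a b)"
    unfolding eq by (rule swap_stepI) (use cd in \<open>auto simp: transpose_def\<close>)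
  then have "reach X Y (\<sigma>' \<circ> transpose a b) (\<sigma> \<circ> transpose a b)"
    using sym by (blast intro: swap_step_sym)
  moreover have "swap_step X Y \<sigma> \<sigma>'" using cd unfolding swap_step_def by blast
  moreover have "reach X Y \<sigma>' (\<sigma>' \<circ> transpose a b)" using step by blast
  ultimately show ?case by (meson converse_rtranclp_into_rtranclp rtranclp_trans)
qed

text \<open>
  In the following simulation, \<open>c ! i\<close> is the index of the position whose original occupant now
  stands at position \<open>i\<close>.  The move sequences below were found by breadth-first search.
\<close>

fun play :: "(nat \<times> nat) list \<Rightarrow> (nat \<times> nat) list \<Rightarrow> (nat \<times> nat) list \<Rightarrow> nat list \<Rightarrow> nat list option" where
  "play XE YE [] c = Some c"
| "play XE YE ((i, j) # w) c =
    (if (i, j) \<in> set XE \<and> ((c ! i, c ! j) \<in> set YE \<or> (c ! j, c ! i) \<in> set YE)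
     then play XE YE w (c[i := c ! j, j := c ! i]) else None)"

text \<open>Induction on the word \<open>w\<close>: the list \<open>c\<close> always records which
  original occupant stands at each position of \<open>ps\<close>, and all other positions are
  untouched. Pairs in \<open>YE\<close> may be used in either order, which is where the symmetry of
  \<open>Y\<close> enters.\<close>

lemma play_reach:
  assumes sym: "symp Y" and "distinct ps"
    and XE: "\<forall>(i, j) \<in> set XE. i < length ps \<and> j < length ps \<and> X (ps ! i) (ps ! j)"
    and YE: "\<forall>(i, j) \<in> set YE. Y (\<sigma> (ps ! i)) (\<sigma> (ps ! j))"
    and "play XE YE w c = Some c'"
    and "length c = length ps" "\<forall>i < length ps. \<tau> (ps ! i) = \<sigma> (ps ! (c ! i))"
      "\<forall>x. x \<notin> set ps \<longrightarrow> \<tau> x = \<sigma> x"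
  shows "\<exists>\<tau>'. reach X Y \<tau> \<tau>' \<and> (\<forall>i < length ps. \<tau>' (ps ! i) = \<sigma> (ps ! (c' ! i))) \<and>
      (\<forall>x. x \<notin> set ps \<longrightarrow> \<tau>' x = \<sigma> x)"
  using assms(5-)
proof (induction w arbitrary: c \<tau>)
  case Nil
  then show ?case by auto
next
  case (Cons e w)
  obtain i j where e: "e = (i, j)" by (cases e)
  from Cons.prems(1) have ij: "(i, j) \<in> set XE" and
    cc: "(c ! i, c ! j) \<in> set YE \<or> (c ! j, c ! i) \<in> set YE" and
    pl: "play XE YE w (c[i := c ! j, j := c ! i]) = Some c'"
    by (auto simp: e split: if_splits)
  have lt: "i < length ps" "j < length ps" and Xij: "X (ps ! i) (ps ! j)" using XE ij by auto
  have "Y (\<sigma> (ps ! (c ! i))) (\<sigma> (ps ! (c ! j)))" using cc YE sym by (auto dest: sympD)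
  then have "Y (\<tau> (ps ! i)) (\<tau> (ps ! j))" using Cons.prems(3) lt by simp
  then have st: "swap_step X Y \<tau> (\<tau> \<circ> transpose (ps ! i) (ps ! j))"
    using Xij by (rule swap_stepI[rotated])
  have "\<exists>\<tau>'. reach X Y (\<tau> \<circ> transpose (ps ! i) (ps ! j)) \<tau>' \<and>
      (\<forall>i < length ps. \<tau>' (ps ! i) = \<sigma> (ps ! (c' ! i))) \<and> (\<forall>x. x \<notin> set ps \<longrightarrow> \<tau>' x = \<sigma> x)"
  proof (rule Cons.IH[OF pl])
    show "length (c[i := c ! j, j := c ! i]) = length ps" using Cons.prems(2) by simp
    show "\<forall>k<length ps. (\<tau> \<circ> transpose (ps ! i) (ps ! j)) (ps ! k) = \<sigma> (ps ! (c[i := c ! j, j := c ! i] ! k))"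
      using Cons.prems(2,3) lt assms(2)
      by (auto simp: nth_list_update transpose_def nth_eq_iff_index_eq)
    show "\<forall>x. x \<notin> set ps \<longrightarrow> (\<tau> \<circ> transpose (ps ! i) (ps ! j)) x = \<sigma> x"
    proof (intro allI impI)
      fix x assume "x \<notin> set ps"
      moreover from this have "x \<noteq> ps ! i" "x \<noteq> ps ! j" using lt by auto
      ultimately show "(\<tau> \<circ> transpose (ps ! i) (ps ! j)) x = \<sigma> x" using Cons.prems(4) by simp
    qed
  qed
  with st show ?case by (meson converse_rtranclp_into_rtranclp)
qed

text \<open>The final list is the identity list with entries \<open>0\<close> and \<open>k\<close>
  interchanged. Evaluating \<open>play\<close> on one concrete word thus proves the exchange in
  every pair of graphs that contains the listed edges.\<close>

lemma play_exchange:
  assumes "symp Y" and d: "distinct ps"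
    and "\<forall>(i, j) \<in> set XE. i < length ps \<and> j < length ps \<and> X (ps ! i) (ps ! j)"
    and "\<forall>(i, j) \<in> set YE. Y (\<sigma> (ps ! i)) (\<sigma> (ps ! j))"
    and "play XE YE w [0..<length ps] = Some ([0..<length ps][0 := k, k := 0])"
    and k: "0 < k" "k < length ps"
  shows "reach X Y \<sigma> (\<sigma> \<circ> transpose (ps ! 0) (ps ! k))"
proof -
  let ?c = "[0..<length ps][0 := k, k := 0]"
  obtain \<tau> where \<tau>: "reach X Y \<sigma> \<tau>" "\<forall>i < length ps. \<tau> (ps ! i) = \<sigma> (ps ! (?c ! i))"
    "\<forall>x. x \<notin> set ps \<longrightarrow> \<tau> x = \<sigma> x"
    using play_reach[OF assms(1-5), of \<sigma>] by auto
  have "\<tau> = \<sigma> \<circ> transpose (ps ! 0) (ps ! k)"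
  proof
    fix x
    show "\<tau> x = (\<sigma> \<circ> transpose (ps ! 0) (ps ! k)) x"
    proof (cases "x \<in> set ps")
      case True
      then obtain i where i: "i < length ps" "x = ps ! i" by (auto simp: in_set_conv_nth)
      have "0 < length ps" using i by auto
      then show ?thesis using \<tau>(2) i d k
        by (auto simp: nth_list_update transpose_def nth_eq_iff_index_eq)
    next
      case False
      moreover have "ps ! 0 \<in> set ps" "ps ! k \<in> set ps" using k by (auto intro: nth_mem)
      ultimately have "x \<noteq> ps ! 0" "x \<noteq> ps ! k" by auto
      then show ?thesis using \<tau>(3) False by simp
    qed
  qed
  then show ?thesis using \<tau>(1) by simp
qed

section \<open>Exchanges on small configurations\<close>

context
  fixes X :: "'a \<Rightarrow> 'a \<Rightarrow> bool" and Y :: "'b \<Rightarrow> 'b \<Rightarrow> bool" and \<sigma> :: "'a \<Rightarrow> 'b"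
  assumes Y: "symp Y"
begin

text \<open>The assumed edges of \<open>X\<close> form a K_{3,2} with parts \<open>u\<close>,
  \<open>w1\<close>, \<open>w2\<close> and \<open>v\<close>, \<open>x\<close>; the assumed
  friendships form the same K_{3,2} without the pair at \<open>u\<close>, \<open>v\<close>. Nine
  swaps make up for the missing friendship.\<close>

lemma exchange_2_common_left:
  assumes "distinct [u, w1, w2, v, x]"
    and "X u v" "X u x" "X w1 v" "X w1 x" "X w2 v" "X w2 x"
    and "Y (\<sigma> u) (\<sigma> x)" "Y (\<sigma> w1) (\<sigma> v)"
      "Y (\<sigma> w1) (\<sigma> x)" "Y (\<sigma> w2) (\<sigma> v)"
      "Y (\<sigma> w2) (\<sigma> x)"
  shows "reach X Y \<sigma> (\<sigma> \<circ> transpose u v)"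
proof -
  let ?ps = "[u, w1, w2, v, x]"
  have "reach X Y \<sigma> (\<sigma> \<circ> transpose (?ps ! 0) (?ps ! 3))"
    by (rule play_exchange[OF Y assms(1), where
          XE = "[(0, 3), (0, 4), (1, 3), (1, 4), (2, 3), (2, 4)]" and
          YE = "[(0, 4), (1, 3), (1, 4), (2, 3), (2, 4)]" and
          w = "[(1, 3), (2, 4), (2, 3), (0, 3), (0, 4), (2, 4), (1, 4), (0, 4), (2, 4)]"])
      (use assms in \<open>simp_all add: upt_rec\<close>)
  then show ?thesis by simp
qed

text \<open>The mirror image, with three positions on the side of \<open>v\<close>.\<close>

lemma exchange_2_common_right:
  assumes "distinct [u, w, v, x1, x2]"
    and "X u v" "X u x1" "X u x2" "X w v" "X w x1" "X w x2"
    and "Y (\<sigma> u) (\<sigma> x1)" "Y (\<sigma> u) (\<sigma> x2)"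
      "Y (\<sigma> w) (\<sigma> v)" "Y (\<sigma> w) (\<sigma> x1)"
      "Y (\<sigma> w) (\<sigma> x2)"
  shows "reach X Y \<sigma> (\<sigma> \<circ> transpose u v)"
proof -
  let ?ps = "[u, w, v, x1, x2]"
  have "reach X Y \<sigma> (\<sigma> \<circ> transpose (?ps ! 0) (?ps ! 2))"
    by (rule play_exchange[OF Y assms(1), where
          XE = "[(0, 2), (0, 3), (0, 4), (1, 2), (1, 3), (1, 4)]" and
          YE = "[(0, 3), (0, 4), (1, 2), (1, 3), (1, 4)]" and
          w = "[(0, 3), (1, 4), (0, 4), (0, 2), (1, 2), (1, 4), (1, 3), (1, 2), (1, 4)]"])
      (use assms in \<open>simp_all add: upt_rec\<close>)
  then show ?thesis by simp
qed

text \<open>In the intended use \<open>u\<close>, \<open>w1\<close>, \<open>q0\<close> lie in one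
  part and \<open>p0\<close>, \<open>v\<close>, \<open>x1\<close> in the other, and the occupants of
  \<open>p0\<close> and \<open>q0\<close> stand on the wrong sides. In this variant
  \<open>p0\<close> and \<open>q0\<close> are adjacent positions, while \<open>w1\<close> and
  \<open>x1\<close> hold friends.\<close>

lemma exchange_via_misplaced_X:
  assumes "distinct [u, w1, p0, v, x1, q0]"
    and "X u p0" "X u x1" "X w1 p0" "X w1 v" "X q0 p0" "X q0 v" "X q0 x1"
    and "Y (\<sigma> u) (\<sigma> x1)" "Y (\<sigma> u) (\<sigma> q0)"
      "Y (\<sigma> w1) (\<sigma> v)" "Y (\<sigma> w1) (\<sigma> x1)"
      "Y (\<sigma> w1) (\<sigma> q0)" "Y (\<sigma> p0) (\<sigma> v)"
      "Y (\<sigma> p0) (\<sigma> x1)"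
  shows "reach X Y \<sigma> (\<sigma> \<circ> transpose u v)"
proof -
  let ?ps = "[u, w1, p0, v, x1, q0]"
  have "reach X Y \<sigma> (\<sigma> \<circ> transpose (?ps ! 0) (?ps ! 3))"
    by (rule play_exchange[OF Y assms(1), where
          XE = "[(0, 2), (0, 4), (1, 2), (1, 3), (5, 2), (5, 3), (5, 4)]" and
          YE = "[(0, 4), (0, 5), (1, 3), (1, 4), (1, 5), (2, 3), (2, 4)]" and
          w = "[(0, 4), (0, 2), (1, 3), (5, 3), (5, 2), (1, 2), (0, 2), (5, 4), (5, 3)]"])
      (use assms in \<open>simp_all add: upt_rec\<close>)
  then show ?thesis by simp
qed

text \<open>The counterpart in which \<open>p0\<close> and \<open>q0\<close> hold friends, while
  \<open>w1\<close> and \<open>x1\<close> are adjacent positions.\<close>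

lemma exchange_via_misplaced_Y:
  assumes "distinct [u, w1, p0, v, x1, q0]"
    and "X u p0" "X u x1" "X w1 p0" "X w1 v" "X w1 x1" "X q0 v" "X q0 x1"
    and "Y (\<sigma> u) (\<sigma> x1)" "Y (\<sigma> u) (\<sigma> q0)"
      "Y (\<sigma> w1) (\<sigma> v)" "Y (\<sigma> w1) (\<sigma> q0)"
      "Y (\<sigma> p0) (\<sigma> v)" "Y (\<sigma> p0) (\<sigma> x1)"
      "Y (\<sigma> p0) (\<sigma> q0)"
  shows "reach X Y \<sigma> (\<sigma> \<circ> transpose u v)"
proof -
  let ?ps = "[u, w1, p0, v, x1, q0]"
  have "reach X Y \<sigma> (\<sigma> \<circ> transpose (?ps ! 0) (?ps ! 3))"
    by (rule play_exchange[OF Y assms(1), where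
          XE = "[(0, 2), (0, 4), (1, 2), (1, 3), (1, 4), (5, 3), (5, 4)]" and
          YE = "[(0, 4), (0, 5), (1, 3), (1, 5), (2, 3), (2, 4), (2, 5)]" and
          w = "[(0, 4), (1, 3), (1, 2), (5, 4), (1, 4), (0, 4), (0, 2), (1, 3), (5, 3)]"])
      (use assms in \<open>simp_all add: upt_rec\<close>)
  then show ?thesis by simp
qed

text \<open>Here a second position \<open>x2\<close>, adjacent to \<open>w1\<close> just like
  \<open>x1\<close>, takes the place of an edge between \<open>p0\<close> and
  \<open>q0\<close>.\<close>

lemma exchange_via_misplaced_XX:
  assumes "distinct [u, w1, p0, v, x1, x2, q0]"
    and "X u p0" "X u x1" "X u x2" "X w1 p0" "X w1 v" "X w1 x1" "X w1 x2" "X q0 v" "X q0 x1"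
      "X q0 x2"
    and "Y (\<sigma> u) (\<sigma> x1)" "Y (\<sigma> u) (\<sigma> x2)"
      "Y (\<sigma> u) (\<sigma> q0)" "Y (\<sigma> w1) (\<sigma> v)"
      "Y (\<sigma> w1) (\<sigma> q0)" "Y (\<sigma> p0) (\<sigma> v)"
      "Y (\<sigma> p0) (\<sigma> x1)" "Y (\<sigma> p0) (\<sigma> x2)"
  shows "reach X Y \<sigma> (\<sigma> \<circ> transpose u v)"
proof -
  let ?ps = "[u, w1, p0, v, x1, x2, q0]"
  have "reach X Y \<sigma> (\<sigma> \<circ> transpose (?ps ! 0) (?ps ! 3))"
    by (rule play_exchange[OF Y assms(1), where
          XE = "[(0, 2), (0, 4), (0, 5), (1, 2), (1, 3), (1, 4), (1, 5), (6, 3), (6, 4), (6, 5)]" and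
          YE = "[(0, 4), (0, 5), (0, 6), (1, 3), (1, 6), (2, 3), (2, 4), (2, 5)]" and
          w = "[(0, 4), (1, 3), (1, 2), (6, 4), (1, 5), (0, 5), (0, 2), (6, 5), (1, 5), (1, 4),
            (1, 3), (6, 4), (6, 3)]"])
      (use assms in \<open>simp_all add: upt_rec\<close>)
  then show ?thesis by simp
qed

lemma exchange_via_misplaced_YY:
  assumes "distinct [u, w1, p0, v, x1, x2, q0]"
    and "X u p0" "X u v" "X u x1" "X u x2" "X w1 p0" "X w1 v"
    and "Y (\<sigma> u) (\<sigma> x1)" "Y (\<sigma> u) (\<sigma> x2)"
      "Y (\<sigma> w1) (\<sigma> v)" "Y (\<sigma> w1) (\<sigma> x1)"
      "Y (\<sigma> w1) (\<sigma> x2)" "Y (\<sigma> p0) (\<sigma> v)"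
      "Y (\<sigma> p0) (\<sigma> x1)" "Y (\<sigma> p0) (\<sigma> x2)"
  shows "reach X Y \<sigma> (\<sigma> \<circ> transpose u v)"
proof -
  let ?ps = "[u, w1, p0, v, x1, x2, q0]"
  have "reach X Y \<sigma> (\<sigma> \<circ> transpose (?ps ! 0) (?ps ! 3))"
    by (rule play_exchange[OF Y assms(1), where
          XE = "[(0, 2), (0, 3), (0, 4), (0, 5), (1, 2), (1, 3)]" and
          YE = "[(0, 4), (0, 5), (1, 3), (1, 4), (1, 5), (2, 3), (2, 4), (2, 5)]" and
          w = "[(0, 4), (0, 2), (0, 5), (1, 3), (0, 3), (0, 2), (0, 4), (0, 3), (0, 5), (1, 2), (0, 2)]"])
      (use assms in \<open>simp_all add: upt_rec\<close>)
  then show ?thesis by simp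
qed

text \<open>This is the extremal straight configuration: common edges match \<open>w1\<close> with
  \<open>x1\<close> and \<open>w2\<close> with \<open>x2\<close>, while \<open>y\<close> and
  \<open>z\<close> are spare positions in the parts of \<open>u\<close> and \<open>v\<close>. Of the
  two unmatched pairs, \<open>w1\<close>, \<open>x2\<close> holds friends.\<close>

lemma exchange_matching_Y:
  assumes "distinct [u, y, w1, w2, v, z, x1, x2]"
    and "X u v" "X u x1" "X u x2" "X y x1" "X y x2" "X w1 v" "X w1 z" "X w1 x1" "X w2 v"
      "X w2 z" "X w2 x2"
    and "Y (\<sigma> u) (\<sigma> x1)" "Y (\<sigma> u) (\<sigma> x2)"
      "Y (\<sigma> y) (\<sigma> x1)" "Y (\<sigma> y) (\<sigma> x2)"
      "Y (\<sigma> w1) (\<sigma> v)" "Y (\<sigma> w1) (\<sigma> z)"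
      "Y (\<sigma> w1) (\<sigma> x1)" "Y (\<sigma> w1) (\<sigma> x2)"
      "Y (\<sigma> w2) (\<sigma> v)" "Y (\<sigma> w2) (\<sigma> z)"
      "Y (\<sigma> w2) (\<sigma> x2)"
  shows "reach X Y \<sigma> (\<sigma> \<circ> transpose u v)"
proof -
  let ?ps = "[u, y, w1, w2, v, z, x1, x2]"
  have "reach X Y \<sigma> (\<sigma> \<circ> transpose (?ps ! 0) (?ps ! 4))"
    by (rule play_exchange[OF Y assms(1), where
          XE = "[(0, 4), (0, 6), (0, 7), (1, 6), (1, 7), (2, 4), (2, 5), (2, 6), (3, 4), (3, 5), (3, 7)]" and
          YE = "[(0, 6), (0, 7), (1, 6), (1, 7), (2, 4), (2, 5), (2, 6), (2, 7), (3, 4), (3, 5), (3, 7)]" and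
          w = "[(0, 7), (2, 4), (3, 5), (3, 4), (1, 6), (1, 7), (3, 7), (0, 7), (1, 7), (1, 6),
            (0, 4), (2, 4), (2, 6), (0, 6), (2, 5), (2, 6), (0, 4), (0, 6), (3, 4), (3, 5),
            (3, 7), (0, 7), (2, 5), (2, 4), (0, 4), (0, 6), (2, 6), (3, 4), (3, 7)]"])
      (use assms in \<open>simp_all add: upt_rec\<close>)
  then show ?thesis by simp
qed

text \<open>The complementary case of the extremal configuration: both unmatched pairs are adjacent
  positions.\<close>

lemma exchange_matching_XX:
  assumes "distinct [u, y, w1, w2, v, z, x1, x2]"
    and "X u v" "X u x1" "X u x2" "X y x1" "X y x2" "X w1 v" "X w1 z" "X w1 x1" "X w1 x2"
      "X w2 z" "X w2 x1" "X w2 x2"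
    and "Y (\<sigma> u) (\<sigma> x1)" "Y (\<sigma> u) (\<sigma> x2)"
      "Y (\<sigma> y) (\<sigma> x1)" "Y (\<sigma> y) (\<sigma> x2)"
      "Y (\<sigma> w1) (\<sigma> v)" "Y (\<sigma> w1) (\<sigma> z)"
      "Y (\<sigma> w1) (\<sigma> x1)" "Y (\<sigma> w2) (\<sigma> v)"
      "Y (\<sigma> w2) (\<sigma> z)" "Y (\<sigma> w2) (\<sigma> x2)"
  shows "reach X Y \<sigma> (\<sigma> \<circ> transpose u v)"
proof -
  let ?ps = "[u, y, w1, w2, v, z, x1, x2]"
  have "reach X Y \<sigma> (\<sigma> \<circ> transpose (?ps ! 0) (?ps ! 4))"
    by (rule play_exchange[OF Y assms(1), where
          XE = "[(0, 4), (0, 6), (0, 7), (1, 6), (1, 7), (2, 4), (2, 5), (2, 6), (2, 7), (3, 5),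
            (3, 6), (3, 7)]" and
          YE = "[(0, 6), (0, 7), (1, 6), (1, 7), (2, 4), (2, 5), (2, 6), (3, 4), (3, 5), (3, 7)]" and
          w = "[(0, 6), (2, 4), (3, 5), (2, 5), (0, 4), (2, 7), (2, 6), (3, 7), (2, 4), (3, 5),
            (1, 6), (2, 6), (0, 6), (3, 6), (3, 7), (0, 7), (0, 6), (3, 5), (2, 7), (2, 6), (1, 7)]"])
      (use assms in \<open>simp_all add: upt_rec\<close>)
  then show ?thesis by simp
qed

end

section \<open>Dense pairs of bipartite graphs\<close>

lemma card_Collect_split:
  assumes "finite S"
  shows "card {x \<in> S. p x} + card {x \<in> S. \<not> p x} = card S"
proof -
  have "card ({x \<in> S. p x} \<union> {x \<in> S. \<not> p x}) = card {x \<in> S. p x} + card {x \<in> S. \<not> p x}"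
    using assms by (intro card_Un_disjoint) auto
  moreover have "{x \<in> S. p x} \<union> {x \<in> S. \<not> p x} = S" by auto
  ultimately show ?thesis by simp
qed

text \<open>The first claim is a union bound. In the second, \<open>D\<close> is as large as that
  bound allows, so it is the whole union and no element can be missing on both counts.\<close>

lemma missing_cases:
  assumes "finite S" "card {y \<in> S. \<not> p y} + card {y \<in> S. \<not> q y} \<le> m"
  shows "card {y \<in> S. \<not> (p y \<and> q y)} \<le> m"
    and "D \<subseteq> {y \<in> S. \<not> (p y \<and> q y)} \<Longrightarrow> m \<le> card D \<Longrightarrow>
      card D = m \<and> (\<forall>y \<in> S. p y \<or> q y) \<and> (\<forall>y \<in> S - D. p y \<and> q y)"
proof -
  let ?p = "{y \<in> S. \<not> p y}" and ?q = "{y \<in> S. \<not> q y}" and ?U = "{y \<in> S. \<not> (p y \<and> q y)}"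
  have fin: "finite ?p" "finite ?q" "finite ?U" using assms(1) by auto
  have U: "?U = ?p \<union> ?q" by auto
  have sum: "card ?U + card (?p \<inter> ?q) = card ?p + card ?q"
    unfolding U using fin(1,2) by (rule card_Un_Int[symmetric])
  show "card ?U \<le> m" using sum assms(2) by linarith
  assume D: "D \<subseteq> ?U" "m \<le> card D"
  have "card D \<le> card ?U" using D(1) fin(3) by (rule card_mono[rotated])
  then have "card D = m" "card ?U = m" "card (?p \<inter> ?q) = 0" using sum D(2) assms(2) by linarith+
  moreover from this have "D = ?U" using D(1) fin(3) by (simp add: card_subset_eq)
  moreover have "?p \<inter> ?q = {}" using \<open>card (?p \<inter> ?q) = 0\<close> fin(1) by simp
  ultimately show "card D = m \<and> (\<forall>y \<in> S. p y \<or> q y) \<and> (\<forall>y \<in> S - D. p y \<and> q y)" by blast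
qed

text \<open>The parts \<open>P\<close>, \<open>Q\<close> of the people are kept apart from the parts
  \<open>A\<close>, \<open>B\<close> of the positions, so that the results apply both to (A, B) and
  to (B, A) in the place of (P, Q). The last bound supplies a second element in the extremal odd
  case.\<close>

locale dense_pair =
  fixes A B P Q :: "'a set" and X Y :: "'a \<Rightarrow> 'a \<Rightarrow> bool" and \<alpha> \<beta> m r :: nat
  assumes finite: "finite A" "finite B"
    and disjoint: "A \<inter> B = {}" "P \<inter> Q = {}"
    and same_union: "P \<union> Q = A \<union> B"
    and cards: "card A = r" "card B = r" "card P = r" "card Q = r"
    and sym_X: "symp X" and sym_Y: "symp Y"
    and missing_X: "\<And>x. x \<in> A \<Longrightarrow> card {y \<in> B. \<not> X x y} \<le> \<alpha>"
      "\<And>x. x \<in> B \<Longrightarrow> card {y \<in> A. \<not> X x y} \<le> \<alpha>"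
    and missing_Y: "\<And>x. x \<in> P \<Longrightarrow> card {y \<in> Q. \<not> Y x y} \<le> \<beta>"
      "\<And>x. x \<in> Q \<Longrightarrow> card {y \<in> P. \<not> Y x y} \<le> \<beta>"
    and bound: "\<alpha> + \<beta> \<le> m" "2 * m + 1 \<le> r" "r = 2 * m + 1 \<Longrightarrow> 2 \<le> m"
begin

section \<open>Counting missing edges under a configuration\<close>

lemma finite_PQ: "finite P" "finite Q"
  using finite same_union by (metis finite_Un)+

lemma X_comm: "X x y \<longleftrightarrow> X y x" and Y_comm: "Y x y \<longleftrightarrow> Y y x"
  using sym_X sym_Y by (auto dest: sympD)

lemma missing_Y_preimage:
  assumes \<sigma>: "\<sigma> permutes A \<union> B" and "S \<subseteq> A \<union> B"
  shows "\<sigma> x \<in> P \<Longrightarrow> \<sigma> ` S \<subseteq> Q \<Longrightarrow> card {y \<in> S. \<not> Y (\<sigma> x) (\<sigma> y)} \<le> \<beta>"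
    and "\<sigma> x \<in> Q \<Longrightarrow> \<sigma> ` S \<subseteq> P \<Longrightarrow> card {y \<in> S. \<not> Y (\<sigma> x) (\<sigma> y)} \<le> \<beta>"
proof -
  have inj: "inj_on \<sigma> {y \<in> S. \<not> Y (\<sigma> x) (\<sigma> y)}" using \<sigma> by (meson permutes_inj inj_on_subset subset_UNIV)
  show "card {y \<in> S. \<not> Y (\<sigma> x) (\<sigma> y)} \<le> \<beta>" if "\<sigma> x \<in> P" "\<sigma> ` S \<subseteq> Q"
  proof -
    have "card {y \<in> S. \<not> Y (\<sigma> x) (\<sigma> y)} \<le> card {y \<in> Q. \<not> Y (\<sigma> x) y}"
      using inj that finite_PQ by (intro card_inj_on_le) auto
    then show ?thesis using missing_Y(1)[OF that(1)] by linarith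
  qed
  show "card {y \<in> S. \<not> Y (\<sigma> x) (\<sigma> y)} \<le> \<beta>" if "\<sigma> x \<in> Q" "\<sigma> ` S \<subseteq> P"
  proof -
    have "card {y \<in> S. \<not> Y (\<sigma> x) (\<sigma> y)} \<le> card {y \<in> P. \<not> Y (\<sigma> x) y}"
      using inj that finite_PQ by (intro card_inj_on_le) auto
    then show ?thesis using missing_Y(2)[OF that(1)] by linarith
  qed
qed

lemma missing_X_subset:
  shows "x \<in> A \<Longrightarrow> S \<subseteq> B \<Longrightarrow> card {y \<in> S. \<not> X x y} \<le> \<alpha>"
    and "x \<in> B \<Longrightarrow> S \<subseteq> A \<Longrightarrow> card {y \<in> S. \<not> X x y} \<le> \<alpha>"
proof -
  show "card {y \<in> S. \<not> X x y} \<le> \<alpha>" if "x \<in> A" "S \<subseteq> B"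
  proof -
    have "card {y \<in> S. \<not> X x y} \<le> card {y \<in> B. \<not> X x y}"
      using that finite by (intro card_mono) auto
    then show ?thesis using missing_X(1)[OF that(1)] by linarith
  qed
  show "card {y \<in> S. \<not> X x y} \<le> \<alpha>" if "x \<in> B" "S \<subseteq> A"
  proof -
    have "card {y \<in> S. \<not> X x y} \<le> card {y \<in> A. \<not> X x y}"
      using that finite by (intro card_mono) auto
    then show ?thesis using missing_X(2)[OF that(1)] by linarith
  qed
qed

lemma missing_both:
  assumes \<sigma>: "\<sigma> permutes A \<union> B"
  shows "x \<in> A \<Longrightarrow> \<sigma> x \<in> P \<Longrightarrow> S \<subseteq> B \<Longrightarrow> \<sigma> ` S \<subseteq> Q \<Longrightarrow>
      card {y \<in> S. \<not> X x y} + card {y \<in> S. \<not> Y (\<sigma> x) (\<sigma> y)} \<le> m"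
    and "x \<in> B \<Longrightarrow> \<sigma> x \<in> Q \<Longrightarrow> S \<subseteq> A \<Longrightarrow> \<sigma> ` S \<subseteq> P \<Longrightarrow>
      card {y \<in> S. \<not> X x y} + card {y \<in> S. \<not> Y (\<sigma> x) (\<sigma> y)} \<le> m"
proof -
  show "card {y \<in> S. \<not> X x y} + card {y \<in> S. \<not> Y (\<sigma> x) (\<sigma> y)} \<le> m"
    if "x \<in> A" "\<sigma> x \<in> P" "S \<subseteq> B" "\<sigma> ` S \<subseteq> Q"
    using missing_X_subset(1)[OF that(1,3)] missing_Y_preimage(1)[OF \<sigma> _ that(2,4)] that(3) bound(1)
    by fastforce
  show "card {y \<in> S. \<not> X x y} + card {y \<in> S. \<not> Y (\<sigma> x) (\<sigma> y)} \<le> m"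
    if "x \<in> B" "\<sigma> x \<in> Q" "S \<subseteq> A" "\<sigma> ` S \<subseteq> P"
    using missing_X_subset(2)[OF that(1,3)] missing_Y_preimage(2)[OF \<sigma> _ that(2,4)] that(3) bound(1)
    by fastforce
qed

text \<open>The r people of \<open>P\<close> are distributed over \<open>A\<close> and
  \<open>B\<close>, and \<open>A\<close> has r positions as well. Hence as many people of
  \<open>Q\<close> stand in \<open>A\<close> as people of \<open>P\<close> in \<open>B\<close>;
  \<open>t\<close> is the number of misplaced people of each class.\<close>

lemma card_classes:
  assumes \<sigma>: "\<sigma> permutes A \<union> B" and t: "t = card {y \<in> B. \<sigma> y \<in> P}"
  shows "card {x \<in> A. \<sigma> x \<in> P} + t = r" "card {x \<in> A. \<sigma> x \<in> Q} = t" "card {y \<in> B. \<sigma> y \<in> Q} + t = r"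
proof -
  have PQ: "\<sigma> x \<in> Q \<longleftrightarrow> \<sigma> x \<notin> P" if "x \<in> A \<union> B" for x
    using permutes_in_image[OF \<sigma>, of x] that same_union disjoint by auto
  have B: "{y \<in> B. \<not> \<sigma> y \<in> P} = {y \<in> B. \<sigma> y \<in> Q}" "{y \<in> A. \<not> \<sigma> y \<in> P} = {y \<in> A. \<sigma> y \<in> Q}"
    using PQ by auto
  have "{x \<in> A. \<sigma> x \<in> P} \<union> {y \<in> B. \<sigma> y \<in> P} = \<sigma> -` P"
    using permutes_in_image[OF \<sigma>] same_union by auto
  moreover have "card (\<sigma> -` P) = card P"
    using permutes_bij[OF \<sigma>] by (intro card_vimage_inj) (auto simp: bij_def)
  moreover have "card ({x \<in> A. \<sigma> x \<in> P} \<union> {y \<in> B. \<sigma> y \<in> P}) = card {x \<in> A. \<sigma> x \<in> P} + card {y \<in> B. \<sigma> y \<in> P}"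
    using finite disjoint by (intro card_Un_disjoint) auto
  ultimately show "card {x \<in> A. \<sigma> x \<in> P} + t = r" using cards t by simp
  with card_Collect_split[OF finite(1), of "\<lambda>x. \<sigma> x \<in> P"] cards B
  show "card {x \<in> A. \<sigma> x \<in> Q} = t" by simp
  show "card {y \<in> B. \<sigma> y \<in> Q} + t = r"
    using card_Collect_split[OF finite(2), of "\<lambda>x. \<sigma> x \<in> P"] cards B t by simp
qed

section \<open>The exchange when all people stand on their prescribed sides\<close>

lemma exchange_if_straight:
  assumes \<sigma>: "\<sigma> permutes A \<union> B" and straight: "\<sigma> ` A \<subseteq> P" "\<sigma> ` B \<subseteq> Q"
    and ab: "a \<in> A" "b \<in> B" "X a b"
  shows "reach X Y \<sigma> (\<sigma> \<circ> transpose a b)"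
proof -
  \<comment> \<open>The common edges: along these a swap is legal at once.\<close>
  define H where "H x y \<longleftrightarrow> X x y \<and> Y (\<sigma> x) (\<sigma> y)" for x y
  have H_comm: "H x y \<longleftrightarrow> H y x" for x y unfolding H_def using X_comm Y_comm by blast
  have missA: "card {y \<in> B. \<not> X x y} + card {y \<in> B. \<not> Y (\<sigma> x) (\<sigma> y)} \<le> m" if "x \<in> A" for x
    using missing_both(1)[OF \<sigma> that] that straight by blast
  have missB: "card {y \<in> A. \<not> X x y} + card {y \<in> A. \<not> Y (\<sigma> x) (\<sigma> y)} \<le> m" if "x \<in> B" for x
    using missing_both(2)[OF \<sigma> that] that straight by blast
  have HA: "card {y \<in> B. \<not> H x y} \<le> m" if "x \<in> A" for x
    using missing_cases(1)[OF finite(2) missA[OF that]] unfolding H_def .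
  have HB: "card {y \<in> A. \<not> H x y} \<le> m" if "x \<in> B" for x
    using missing_cases(1)[OF finite(1) missB[OF that]] unfolding H_def .
  show ?thesis
  proof (cases "Y (\<sigma> a) (\<sigma> b)")
    case True
    then show ?thesis using ab(3) by (intro reachI)
  next
    case False
    define Z where "Z = {y \<in> B. H a y}"
    define W where "W = {y \<in> A. H b y}"
    have fin: "finite Z" "finite W" unfolding Z_def W_def using finite by auto
    have nZ: "b \<notin> Z" "a \<notin> W" using False Y_comm by (auto simp: Z_def W_def H_def)
    have cZ: "card Z + card (B - Z) = r"
    proof -
      have "B - Z = {y \<in> B. \<not> H a y}" by (auto simp: Z_def)
      then show ?thesis using card_Collect_split[OF finite(2), of "H a"] cards by (simp add: Z_def)
    qed
    have cW: "card W + card (A - W) = r"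
    proof -
      have "A - W = {y \<in> A. \<not> H b y}" by (auto simp: W_def)
      then show ?thesis using card_Collect_split[OF finite(1), of "H b"] cards by (simp add: W_def)
    qed
    have BZ: "card (B - Z) \<le> m"
    proof -
      have "B - Z = {y \<in> B. \<not> H a y}" by (auto simp: Z_def)
      then show ?thesis using HA[OF ab(1)] by simp
    qed
    have AW: "card (A - W) \<le> m"
    proof -
      have "A - W = {y \<in> A. \<not> H b y}" by (auto simp: W_def)
      then show ?thesis using HB[OF ab(2)] by simp
    qed
    \<comment> \<open>Two common edges from one \<open>w\<close> to \<open>Z\<close>, together with
      \<open>a\<close> and \<open>b\<close>, give a K_{2,3} lacking only the friendship at
      \<open>a\<close>, \<open>b\<close>; dually for \<open>left\<close>. Otherwise no element of
      \<open>W\<close> or \<open>Z\<close> has two common neighbours in the other set.\<close>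
    consider (right) w x1 x2 where "w \<in> W" "x1 \<in> Z" "x2 \<in> Z" "x1 \<noteq> x2" "H w x1" "H w x2"
      | (left) x w1 w2 where "x \<in> Z" "w1 \<in> W" "w2 \<in> W" "w1 \<noteq> w2" "H w1 x" "H w2 x"
      | (matching) "\<And>w x1 x2. w \<in> W \<Longrightarrow> x1 \<in> Z \<Longrightarrow> x2 \<in> Z \<Longrightarrow> H w x1 \<Longrightarrow> H w x2 \<Longrightarrow> x1 = x2"
        "\<And>x w1 w2. x \<in> Z \<Longrightarrow> w1 \<in> W \<Longrightarrow> w2 \<in> W \<Longrightarrow> H w1 x \<Longrightarrow> H w2 x \<Longrightarrow> w1 = w2"
      by blast
    then show ?thesis
    proof cases
      case right
      have "distinct [a, w, b, x1, x2]"
        using right nZ ab disjoint by (auto simp: Z_def W_def)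
      then show ?thesis
        by (rule exchange_2_common_right[OF sym_Y])
          (use right ab X_comm Y_comm in \<open>auto simp: Z_def W_def H_def\<close>)
    next
      case left
      have "distinct [a, w1, w2, b, x]"
        using left nZ ab disjoint by (auto simp: Z_def W_def)
      then show ?thesis
        by (rule exchange_2_common_left[OF sym_Y])
          (use left ab X_comm Y_comm in \<open>auto simp: Z_def W_def H_def\<close>)
    next
      case matching
      have inner: "card S \<le> Suc (card {y \<in> S. \<not> H x y})"
        if "finite S" "\<And>y1 y2. y1 \<in> S \<Longrightarrow> y2 \<in> S \<Longrightarrow> H x y1 \<Longrightarrow> H x y2 \<Longrightarrow> y1 = y2" for S x
      proof -
        have "card {y \<in> S. H x y} \<le> Suc 0"
          using that by (auto simp: card_le_Suc0_iff_eq)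
        then show ?thesis using card_Collect_split[OF that(1), of "H x"] by linarith
      qed
      have W1: "card Z \<le> Suc (card {y \<in> Z. \<not> H w y})" if "w \<in> W" for w
        using matching(1)[OF that] by (intro inner fin)
      have Z1: "card W \<le> Suc (card {y \<in> W. \<not> H x y})" if "x \<in> Z" for x
        using matching(2)[OF that] H_comm by (intro inner fin) blast+
      have subW: "{y \<in> Z. \<not> H w y} \<subseteq> {y \<in> B. \<not> H w y}" for w by (auto simp: Z_def)
      have subZ: "{y \<in> W. \<not> H w y} \<subseteq> {y \<in> A. \<not> H w y}" for w by (auto simp: W_def)
      have "W \<noteq> {}" using cW AW bound by auto
      then obtain w0 where w0: "w0 \<in> W" by blast
      have "card {y \<in> Z. \<not> H w0 y} \<le> m"
        using card_mono[OF _ subW[of w0]] HA[of w0] w0 finite by (fastforce simp: W_def)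
      \<comment> \<open>Here m + 1 \<le> r - m \<le> |Z| \<le> 1 + m, the last step because
        \<open>w0\<close> has at most one common neighbour in \<open>Z\<close>; so all are
        equalities.\<close>
      then have Zm: "card Z = m + 1" "r = 2 * m + 1" using W1[OF w0] cZ BZ bound by linarith+
      have "Z \<noteq> {}" using cZ BZ bound by auto
      then obtain x0 where x0: "x0 \<in> Z" by blast
      have "card {y \<in> W. \<not> H x0 y} \<le> m"
        using card_mono[OF _ subZ[of x0]] HB[of x0] x0 finite by (fastforce simp: Z_def)
      then have Wm: "card W = m + 1" using Z1[OF x0] cW AW bound by linarith
      have m2: "2 \<le> m" using bound Zm by blast
      have wprop: "(\<forall>y \<in> B. X w y \<or> Y (\<sigma> w) (\<sigma> y)) \<and> (\<forall>y \<in> B - Z. H w y) \<and> (\<exists>y \<in> Z. H w y)"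
        if "w \<in> W" for w
      proof -
        have wA: "w \<in> A" using that by (simp add: W_def)
        have le: "m \<le> card {y \<in> Z. \<not> H w y}" using W1[OF that] Zm by linarith
        \<comment> \<open>The equality case: \<open>w\<close> exhausts its allowance of m missing
          edges inside \<open>Z\<close>, and each of them is missing in one graph only. Since |Z| =
          m + 1, exactly one element of \<open>Z\<close> is left as partner of
          \<open>w\<close>.\<close>
        have *: "card {y \<in> Z. \<not> H w y} = m \<and> (\<forall>y \<in> B. X w y \<or> Y (\<sigma> w) (\<sigma> y)) \<and>
            (\<forall>y \<in> B - {y \<in> Z. \<not> H w y}. X w y \<and> Y (\<sigma> w) (\<sigma> y))"
          by (rule missing_cases(2)[OF finite(2) missA[OF wA] _ le]) (auto simp: Z_def H_def)
        have "\<exists>y \<in> Z. H w y"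
        proof (rule ccontr)
          assume "\<not> ?thesis"
          then have "{y \<in> Z. \<not> H w y} = Z" by auto
          then show False using * Zm by simp
        qed
        moreover have "\<forall>y \<in> B - Z. H w y" unfolding H_def using * by blast
        ultimately show ?thesis using * by blast
      qed
      have xprop: "\<forall>y \<in> A - W. H x y" if "x \<in> Z" for x
      proof -
        have xB: "x \<in> B" using that by (simp add: Z_def)
        have le: "m \<le> card {y \<in> W. \<not> H x y}" using Z1[OF that] Wm by linarith
        have "card {y \<in> W. \<not> H x y} = m \<and> (\<forall>y \<in> A. X x y \<or> Y (\<sigma> x) (\<sigma> y)) \<and>
            (\<forall>y \<in> A - {y \<in> W. \<not> H x y}. X x y \<and> Y (\<sigma> x) (\<sigma> y))"
          by (rule missing_cases(2)[OF finite(1) missB[OF xB] _ le]) (auto simp: W_def H_def)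
        then show ?thesis unfolding H_def by blast
      qed
      have other: "\<exists>z \<in> S. z \<noteq> s" if "2 \<le> card S" for S and s :: 'a
      proof (rule ccontr)
        assume "\<not> ?thesis"
        then have "S \<subseteq> {s}" by auto
        then have "card S \<le> 1" using card_mono[of "{s}" S] by simp
        then show False using that by linarith
      qed
      \<comment> \<open>Both \<open>B - Z\<close> and \<open>A - W\<close> have m \<ge> 2 elements,
        so they contain something besides \<open>b\<close> and \<open>a\<close>.\<close>
      obtain z where z: "z \<in> B - Z" "z \<noteq> b" using other[of "B - Z" b] cZ Zm m2 by auto
      obtain y where y: "y \<in> A - W" "y \<noteq> a" using other[of "A - W" a] cW Zm Wm m2 by auto
      obtain x1 where x1: "x1 \<in> Z" "H w0 x1" using wprop[OF w0] by blast
      obtain w' where w': "w' \<in> W" "w' \<noteq> w0" using other[of W w0] Wm m2 by auto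
      obtain x2 where x2: "x2 \<in> Z" "H w' x2" using wprop[OF w'(1)] by blast
      have ne: "x1 \<noteq> x2" using matching(2) x1 x2 w0 w' by blast
      have fact: "H a x" "H y x" "X w b" "Y (\<sigma> w) (\<sigma> b)" "H w z" "X w x \<or> Y (\<sigma> w) (\<sigma> x)"
        if "w \<in> W" "x \<in> Z" for w x
      proof -
        show "H a x" using that by (simp add: Z_def)
        show "H y x" using xprop[OF that(2)] y H_comm by blast
        show "X w b" "Y (\<sigma> w) (\<sigma> b)" using that X_comm Y_comm by (auto simp: W_def H_def)
        show "H w z" using wprop[OF that(1)] z by blast
        show "X w x \<or> Y (\<sigma> w) (\<sigma> x)" using wprop[OF that(1)] that(2) by (auto simp: Z_def)
      qed
      have main: "reach X Y \<sigma> (\<sigma> \<circ> transpose a b)"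
        if "w1 \<in> W" "w2 \<in> W" "w1 \<noteq> w2" "x1 \<in> Z" "x2 \<in> Z" "x1 \<noteq> x2" "H w1 x1" "H w2 x2"
          and c: "Y (\<sigma> w1) (\<sigma> x2) \<or> X w1 x2 \<and> X w2 x1" for w1 w2 x1 x2
      proof -
        have d: "distinct [a, y, w1, w2, b, z, x1, x2]"
          using that(1-6) nZ y z ab disjoint by (auto simp: Z_def W_def)
        note f = fact[OF that(1,4)] fact[OF that(2,5)] that(7,8) ab(3)
        show ?thesis using c
        proof
          assume "Y (\<sigma> w1) (\<sigma> x2)"
          then show ?thesis
            by (intro exchange_matching_Y[OF sym_Y d]) (use f in \<open>auto simp: H_def\<close>)
        next
          assume "X w1 x2 \<and> X w2 x1"
          then show ?thesis
            by (intro exchange_matching_XX[OF sym_Y d]) (use f in \<open>auto simp: H_def\<close>)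
        qed
      qed
      \<comment> \<open>Each of the two unmatched pairs is joined in at least one graph. If one of
        them holds friends, \<open>main\<close> applies in a suitable order of the two matching
        edges; otherwise both pairs are edges of \<open>X\<close>.\<close>
      show ?thesis
        using main[OF w0 w'(1) w'(2)[symmetric] x1(1) x2(1) ne x1(2) x2(2)]
          main[OF w'(1) w0 w'(2) x2(1) x1(1) ne[symmetric] x2(2) x1(2)]
          fact(6)[OF w0 x2(1)] fact(6)[OF w'(1) x1(1)] by blast
    qed
  qed
qed

section \<open>Straightening a configuration without touching two given positions\<close>

lemma permutes_comp_transpose:
  "\<sigma> permutes S \<Longrightarrow> c \<in> S \<Longrightarrow> d \<in> S \<Longrightarrow> \<sigma> \<circ> transpose c d permutes S"
  by (intro permutes_compose permutes_swap_id)

text \<open>This is the step for configurations in which no two misplaced people can be swapped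
  directly. Such a blockade uses up so many missing edges at \<open>p\<close> and \<open>q\<close>
  that either a detour of three swaps exists or every count is sharp.\<close>

lemma exchange_or_straighten:
  assumes \<sigma>: "\<sigma> permutes A \<union> B"
    and ab: "a \<in> A" "b \<in> B" "X a b" "\<sigma> a \<in> P" "\<sigma> b \<in> Q"
    and pq: "p \<in> B" "\<sigma> p \<in> P" "q \<in> A" "\<sigma> q \<in> Q"
    and no_edge: "\<And>x y. x \<in> B \<Longrightarrow> \<sigma> x \<in> P \<Longrightarrow> y \<in> A \<Longrightarrow> \<sigma> y \<in> Q \<Longrightarrow> \<not> (X x y \<and> Y (\<sigma> x) (\<sigma> y))"
  shows "reach X Y \<sigma> (\<sigma> \<circ> transpose a b) \<or>
    (\<exists>\<tau>. \<tau> permutes A \<union> B \<and> \<tau> a \<in> P \<and> \<tau> b \<in> Q \<and>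
      reach (\<lambda>x y. X x y \<and> x \<notin> {a, b} \<and> y \<notin> {a, b}) Y \<sigma> \<tau> \<and>
      card {y \<in> B. \<tau> y \<in> P} < card {y \<in> B. \<sigma> y \<in> P})"
proof -
  define PA where "PA = {x \<in> A. \<sigma> x \<in> P}"
  define QA where "QA = {x \<in> A. \<sigma> x \<in> Q}"
  define PB where "PB = {x \<in> B. \<sigma> x \<in> P}"
  define QB where "QB = {x \<in> B. \<sigma> x \<in> Q}"
  note defs = PA_def QA_def PB_def QB_def
  define t where "t = card PB"
  have fin: "finite PA" "finite QA" "finite PB" "finite QB" using finite by (auto simp: defs)
  have cs: "card PA + t = r" "card QA = t" "card QB + t = r"
    using card_classes[OF \<sigma>, of t] by (simp_all add: defs t_def)
  have mem: "a \<in> PA" "b \<in> QB" "p \<in> PB" "q \<in> QA" using ab pq by (auto simp: defs)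
  have "t > 0" using mem fin by (auto simp: t_def card_gt_0_iff)
  have PQ: "x \<notin> Q" if "x \<in> P" for x using that disjoint by auto
  have split: "card {y \<in> S. \<not> f y} + card {y \<in> T. \<not> f y} = card {y \<in> S \<union> T. \<not> f y}"
    if "finite S" "finite T" "S \<inter> T = {}" for S T :: "'a set" and f
  proof -
    have "{y \<in> S \<union> T. \<not> f y} = {y \<in> S. \<not> f y} \<union> {y \<in> T. \<not> f y}" by auto
    then show ?thesis using that by (simp add: card_Un_disjoint disjoint_iff)
  qed
  have cover: "t + card {y \<in> S. \<not> f y \<and> \<not> g y} \<le> card {y \<in> S. \<not> f y} + card {y \<in> S. \<not> g y}"
    if "finite S" "card S = t" "\<forall>y \<in> S. \<not> (f y \<and> g y)" for S :: "'a set" and f g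
  proof -
    have "{y \<in> S. \<not> f y} \<union> {y \<in> S. \<not> g y} = S" "{y \<in> S. \<not> f y} \<inter> {y \<in> S. \<not> g y} = {y \<in> S. \<not> f y \<and> \<not> g y}"
      using that(3) by auto
    then show ?thesis
      using card_Un_Int[of "{y \<in> S. \<not> f y}" "{y \<in> S. \<not> g y}"] that(1,2) by simp
  qed
  let ?x1 = "card {y \<in> QB. \<not> X q y}" and ?y1 = "card {y \<in> PA. \<not> Y (\<sigma> q) (\<sigma> y)}"
  let ?x2 = "card {y \<in> PA. \<not> X p y}" and ?y2 = "card {y \<in> QB. \<not> Y (\<sigma> p) (\<sigma> y)}"
  let ?e = "if X q p \<or> Y (\<sigma> q) (\<sigma> p) then 0 else 1 :: nat"
  \<comment> \<open>Each of the t positions in \<open>PB\<close> is cut off from \<open>q\<close> in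
    at least one graph, and \<open>p\<close> in both when \<open>?e\<close> is 1. Together with the
    edges that \<open>q\<close> misses towards \<open>QB\<close> in \<open>X\<close> and towards
    \<open>PA\<close> in \<open>Y\<close>, the total is at most \<alpha> + \<beta>.\<close>
  have q_miss: "?x1 + ?y1 + t + ?e \<le> m"
  proof -
    have "?x1 + card {y \<in> PB. \<not> X q y} = card {y \<in> QB \<union> PB. \<not> X q y}"
      using fin PQ by (intro split) (auto simp: defs)
    also have "\<dots> \<le> \<alpha>" using mem by (intro missing_X_subset(1)) (auto simp: defs)
    finally have 1: "?x1 + card {y \<in> PB. \<not> X q y} \<le> \<alpha>" .
    have "?y1 + card {y \<in> PB. \<not> Y (\<sigma> q) (\<sigma> y)} = card {y \<in> PA \<union> PB. \<not> Y (\<sigma> q) (\<sigma> y)}"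
      using fin disjoint by (intro split) (auto simp: defs)
    also have "\<dots> \<le> \<beta>" using mem by (intro missing_Y_preimage(2)[OF \<sigma>]) (auto simp: defs)
    finally have 2: "?y1 + card {y \<in> PB. \<not> Y (\<sigma> q) (\<sigma> y)} \<le> \<beta>" .
    have 3: "t + card {y \<in> PB. \<not> X q y \<and> \<not> Y (\<sigma> q) (\<sigma> y)}
        \<le> card {y \<in> PB. \<not> X q y} + card {y \<in> PB. \<not> Y (\<sigma> q) (\<sigma> y)}"
      using fin no_edge mem X_comm Y_comm by (intro cover) (auto simp: t_def defs)
    have "?e \<le> card {y \<in> PB. \<not> X q y \<and> \<not> Y (\<sigma> q) (\<sigma> y)}"
    proof (cases "X q p \<or> Y (\<sigma> q) (\<sigma> p)")
      case False
      then have "p \<in> {y \<in> PB. \<not> X q y \<and> \<not> Y (\<sigma> q) (\<sigma> y)}" using mem by simp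
      then have "0 < card {y \<in> PB. \<not> X q y \<and> \<not> Y (\<sigma> q) (\<sigma> y)}" using fin by (auto simp: card_gt_0_iff)
      then show ?thesis by simp
    qed simp
    then show ?thesis using 1 2 3 bound(1) by linarith
  qed
  have p_miss: "?x2 + ?y2 + t \<le> m"
  proof -
    have "?x2 + card {y \<in> QA. \<not> X p y} = card {y \<in> PA \<union> QA. \<not> X p y}"
      using fin PQ by (intro split) (auto simp: defs)
    also have "\<dots> \<le> \<alpha>" using mem by (intro missing_X_subset(2)) (auto simp: defs)
    finally have 1: "?x2 + card {y \<in> QA. \<not> X p y} \<le> \<alpha>" .
    have "?y2 + card {y \<in> QA. \<not> Y (\<sigma> p) (\<sigma> y)} = card {y \<in> QB \<union> QA. \<not> Y (\<sigma> p) (\<sigma> y)}"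
      using fin disjoint by (intro split) (auto simp: defs)
    also have "\<dots> \<le> \<beta>" using mem by (intro missing_Y_preimage(1)[OF \<sigma>]) (auto simp: defs)
    finally have 2: "?y2 + card {y \<in> QA. \<not> Y (\<sigma> p) (\<sigma> y)} \<le> \<beta>" .
    have "t + card {y \<in> QA. \<not> X p y \<and> \<not> Y (\<sigma> p) (\<sigma> y)}
        \<le> card {y \<in> QA. \<not> X p y} + card {y \<in> QA. \<not> Y (\<sigma> p) (\<sigma> y)}"
      using fin cs no_edge mem by (intro cover) (auto simp: defs)
    then show ?thesis using 1 2 bound(1) by linarith
  qed
  \<comment> \<open>Membership of g and h in these sets makes two swaps of the detour legal: at
    \<open>q\<close>, h, after g's occupant has moved to h, and at \<open>p\<close>, g, after h's
    occupant has moved to g. Neither swap involves \<open>a\<close> or \<open>b\<close>.\<close>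
  define G where "G = {y \<in> PA. y \<noteq> a \<and> X p y \<and> Y (\<sigma> q) (\<sigma> y)}"
  define G' where "G' = {y \<in> QB. y \<noteq> b \<and> X q y \<and> Y (\<sigma> p) (\<sigma> y)}"
  have good: "card S \<le> card {y \<in> S. y \<noteq> s \<and> f y \<and> g y} + card {y \<in> S. \<not> f y} + card {y \<in> S. \<not> g y}
      + (if f s \<and> g s then 1 else 0)"
    if "finite S" for S :: "'a set" and s f g
  proof -
    let ?s = "if f s \<and> g s then {s} else {}"
    have "S \<subseteq> {y \<in> S. y \<noteq> s \<and> f y \<and> g y} \<union> {y \<in> S. \<not> f y} \<union> {y \<in> S. \<not> g y} \<union> ?s" by auto
    then have "card S \<le> card ({y \<in> S. y \<noteq> s \<and> f y \<and> g y} \<union> {y \<in> S. \<not> f y} \<union> {y \<in> S. \<not> g y} \<union> ?s)"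
      using that by (intro card_mono) auto
    also have "\<dots> \<le> card {y \<in> S. y \<noteq> s \<and> f y \<and> g y} + card {y \<in> S. \<not> f y} + card {y \<in> S. \<not> g y} + card ?s"
      by (intro order.trans[OF card_Un_le] add_mono order.refl)
    finally show ?thesis by (simp split: if_splits)
  qed
  let ?ea = "if X p a \<and> Y (\<sigma> q) (\<sigma> a) then 1 else 0 :: nat"
  let ?eb = "if X q b \<and> Y (\<sigma> p) (\<sigma> b) then 1 else 0 :: nat"
  have G: "card PA \<le> card G + ?x2 + ?y1 + ?ea"
    using good[OF fin(1), of a "X p" "\<lambda>y. Y (\<sigma> q) (\<sigma> y)"] unfolding G_def .
  have G': "card QB \<le> card G' + ?x1 + ?y2 + ?eb"
    using good[OF fin(4), of b "X q" "\<lambda>y. Y (\<sigma> p) (\<sigma> y)"] unfolding G'_def .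
  have le1: "?ea \<le> 1" "?eb \<le> 1" by simp_all
  \<comment> \<open>|G| \<ge> (r - t) - 2 (m - t) - 1 \<ge> t, since r \<ge> 2m + 1; likewise for
    \<open>G'\<close>.\<close>
  have pos: "0 < card G" "0 < card G'"
    using G G' q_miss p_miss cs bound(2) \<open>t > 0\<close> le1 by linarith+
  \<comment> \<open>Swapping \<open>g\<close> with \<open>h\<close>, then \<open>h\<close> with \<open>q\<close> and \<open>g\<close> with \<open>p\<close>, straightens the blocked pair \<open>p\<close>, \<open>q\<close>.
    If no such edge exists, every estimate above is an equality, which determines enough edges.\<close>
  show ?thesis
  proof (cases "\<exists>g \<in> G. \<exists>h \<in> G'. X g h \<and> Y (\<sigma> g) (\<sigma> h)")
    case True
    then obtain g h where gh: "g \<in> G" "h \<in> G'" "X g h" "Y (\<sigma> g) (\<sigma> h)" by blast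
    let ?X = "\<lambda>x y. X x y \<and> x \<notin> {a, b} \<and> y \<notin> {a, b}"
    have g: "g \<in> A" "\<sigma> g \<in> P" "g \<noteq> a" "X p g" "Y (\<sigma> q) (\<sigma> g)"
      and h: "h \<in> B" "\<sigma> h \<in> Q" "h \<noteq> b" "X q h" "Y (\<sigma> p) (\<sigma> h)"
      using gh by (auto simp: G_def G'_def defs)
    have ne: "g \<noteq> q" "p \<noteq> h" "q \<noteq> a" "p \<noteq> b" using g h pq ab PQ by auto
    have AB: "x \<noteq> y" if "x \<in> A" "y \<in> B" for x y using that disjoint by auto
    note ne' = ne g(3) h(3) AB[OF g(1) h(1)] AB[OF g(1) pq(1)] AB[OF pq(3) h(1)] AB[OF pq(3) pq(1)]
      AB[OF ab(1) h(1)] AB[OF ab(1) pq(1)] AB[OF g(1) ab(2)] AB[OF pq(3) ab(2)] AB[OF ab(1,2)]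
    note ne'' = ne' ne'[symmetric]
    define \<tau> where "\<tau> = \<sigma> \<circ> transpose g h \<circ> transpose q h \<circ> transpose p g"
    have "swap_step ?X Y \<sigma> (\<sigma> \<circ> transpose g h)"
      using gh ne'' by (intro swap_stepI) auto
    moreover have "swap_step ?X Y (\<sigma> \<circ> transpose g h) (\<sigma> \<circ> transpose g h \<circ> transpose q h)"
      using g h ne'' by (intro swap_stepI) auto
    moreover have "swap_step ?X Y (\<sigma> \<circ> transpose g h \<circ> transpose q h) \<tau>"
      unfolding \<tau>_def using g h ne'' by (intro swap_stepI) (auto simp: transpose_def)
    ultimately have reach: "reach ?X Y \<sigma> \<tau>"
      by (meson rtranclp.rtrancl_into_rtrancl rtranclp.rtrancl_refl)
    have perm: "\<tau> permutes A \<union> B"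
      unfolding \<tau>_def using \<sigma> g h pq by (intro permutes_comp_transpose) auto
    have val: "\<tau> a = \<sigma> a" "\<tau> b = \<sigma> b" "\<tau> p = \<sigma> h" "\<tau> h = \<sigma> q"
      using ne'' by (auto simp: \<tau>_def transpose_def)
    have val': "\<tau> x = \<sigma> x" if "x \<noteq> g" "x \<noteq> h" "x \<noteq> p" "x \<noteq> q" for x
      using that by (auto simp: \<tau>_def transpose_def)
    have "{y \<in> B. \<tau> y \<in> P} \<subseteq> {y \<in> B. \<sigma> y \<in> P} - {p}"
    proof
      fix y assume "y \<in> {y \<in> B. \<tau> y \<in> P}"
      then have y: "y \<in> B" "\<tau> y \<in> P" by auto
      have "y \<noteq> g" "y \<noteq> q" using y g pq AB by blast+
      moreover have "y \<noteq> h" "y \<noteq> p" using y val h pq PQ by metis+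
      ultimately show "y \<in> {y \<in> B. \<sigma> y \<in> P} - {p}" using y val' by auto
    qed
    then have "{y \<in> B. \<tau> y \<in> P} \<subset> {y \<in> B. \<sigma> y \<in> P}" using pq by blast
    then have "card {y \<in> B. \<tau> y \<in> P} < card {y \<in> B. \<sigma> y \<in> P}"
      using finite by (intro psubset_card_mono) auto
    moreover have "\<tau> a \<in> P" "\<tau> b \<in> Q" using val ab by simp_all
    ultimately show ?thesis using reach perm by blast
  next
    case False
    have G_A: "g \<in> A" "\<sigma> g \<in> P" if "g \<in> G" for g using that by (auto simp: G_def defs)
    have G'_B: "h \<in> B" "\<sigma> h \<in> Q" if "h \<in> G'" for h using that by (auto simp: G'_def defs)
    have sub: "G \<subseteq> PA" "G' \<subseteq> QB" by (auto simp: G_def G'_def)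
    have missA: "card {y \<in> QB. \<not> X x y} + card {y \<in> QB. \<not> Y (\<sigma> x) (\<sigma> y)} \<le> m" if "x \<in> A" "\<sigma> x \<in> P" for x
      using that by (intro missing_both(1)[OF \<sigma>]) (auto simp: defs)
    have missB: "card {y \<in> PA. \<not> X x y} + card {y \<in> PA. \<not> Y (\<sigma> x) (\<sigma> y)} \<le> m" if "x \<in> B" "\<sigma> x \<in> Q" for x
      using that by (intro missing_both(2)[OF \<sigma>]) (auto simp: defs)
    have subA: "G' \<subseteq> {y \<in> QB. \<not> (X g y \<and> Y (\<sigma> g) (\<sigma> y))}" if "g \<in> G" for g
      using False that sub by blast
    have subB: "G \<subseteq> {y \<in> PA. \<not> (X h y \<and> Y (\<sigma> h) (\<sigma> y))}" if "h \<in> G'" for h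
      using False that sub X_comm Y_comm by blast
    obtain g where g: "g \<in> G" using pos by (auto simp: card_gt_0_iff)
    obtain h0 where h0: "h0 \<in> G'" using pos by (auto simp: card_gt_0_iff)
    have "card G' \<le> m"
      by (rule order.trans[OF card_mono[OF _ subA[OF g]]
            missing_cases(1)[OF fin(4) missA[OF G_A[OF g]]]]) (use fin in simp)
    moreover have "card G \<le> m"
      by (rule order.trans[OF card_mono[OF _ subB[OF h0]]
            missing_cases(1)[OF fin(1) missB[OF G'_B[OF h0]]]]) (use fin in simp)
    moreover have "card PA + card QB + 2 * t = 2 * r" using cs by linarith
    \<comment> \<open>Adding the two lower bounds gives 2 (r - t) \<le> |G| + |G'| + 2 (m - t) -
      \<open>?e\<close> + 2 \<le> 2 (2m + 1 - t) - \<open>?e\<close>. As r \<ge> 2m + 1, every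
      estimate involved is an equality.\<close>
    ultimately have tight: "card G = m" "card G' = m" "r = 2 * m + 1" "?ea = 1" "?eb = 1" "?e = 0"
      using G G' q_miss p_miss bound(2) le1 by linarith+
    have m2: "2 \<le> m" using bound tight by blast
    have a_edges: "X p a" "Y (\<sigma> q) (\<sigma> a)" using tight(4) by (simp_all split: if_splits)
    have b_edges: "X q b" "Y (\<sigma> p) (\<sigma> b)" using tight(5) by (simp_all split: if_splits)
    have pq_edge: "X q p \<or> Y (\<sigma> q) (\<sigma> p)" using tight(6) by (simp split: if_splits)
    have g_edges: "(\<forall>y \<in> QB. X g y \<or> Y (\<sigma> g) (\<sigma> y)) \<and> (\<forall>y \<in> QB - G'. X g y \<and> Y (\<sigma> g) (\<sigma> y))"
      using missing_cases(2)[OF fin(4) missA[OF G_A[OF g]] subA[OF g]] tight by simp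
    have h_edges: "\<forall>y \<in> PA - G. X h y \<and> Y (\<sigma> h) (\<sigma> y)" if "h \<in> G'" for h
      using missing_cases(2)[OF fin(1) missB[OF G'_B[OF that]] subB[OF that]] tight by simp
    have "b \<in> QB - G'" "a \<in> PA - G" using mem by (auto simp: G_def G'_def)
    then have Hgb: "X g b" "Y (\<sigma> g) (\<sigma> b)" and Hah: "X a h" "Y (\<sigma> a) (\<sigma> h)" if "h \<in> G'" for h
      using g_edges h_edges[OF that] X_comm Y_comm that by blast+
    note Hgb = Hgb[OF h0]
    have gg: "g \<in> A" "\<sigma> g \<in> P" "g \<noteq> a" "X g p" "Y (\<sigma> g) (\<sigma> q)"
      using g X_comm Y_comm by (auto simp: G_def defs)
    have hh: "h \<in> B" "\<sigma> h \<in> Q" "h \<noteq> b" "X q h" "Y (\<sigma> p) (\<sigma> h)" "X g h \<or> Y (\<sigma> g) (\<sigma> h)"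
      if "h \<in> G'" for h
      using that g_edges by (auto simp: G'_def defs)
    have "\<exists>h1 \<in> G'. h1 \<noteq> h0"
    proof (rule ccontr)
      assume "\<not> ?thesis"
      then have "card G' \<le> card {h0}" by (intro card_mono) auto
      then show False using tight m2 by simp
    qed
    then obtain h1 where h1: "h1 \<in> G'" "h1 \<noteq> h0" by blast
    have edges: "X a b" "X a p" "Y (\<sigma> a) (\<sigma> q)" "X q b" "Y (\<sigma> p) (\<sigma> b)"
      using ab a_edges b_edges X_comm Y_comm by blast+
    have dist: "distinct [a, g, p, b, h, q]" if "h \<in> G'" for h
      using ab gg(1-3) hh(1-3)[OF that] pq disjoint by auto
    have dist2: "distinct [a, g, p, b, h0, h1, q]"
      using dist[OF h0] dist[OF h1(1)] h1(2) by simp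
    note h0e = hh(4-6)[OF h0] Hah[OF h0] and h1e = hh(4-6)[OF h1(1)] Hah[OF h1(1)]
    have "reach X Y \<sigma> (\<sigma> \<circ> transpose a b)"
    proof -
      \<comment> \<open>Both \<open>h0\<close> and \<open>h1\<close> are joined to \<open>g\<close>
        in at least one graph. When both kinds of edges occur, the graph joining \<open>p\<close>
        and \<open>q\<close> decides which of the two positions to use.\<close>
      consider (XX) "X g h0" "X g h1" | (YY) "Y (\<sigma> g) (\<sigma> h0)" "Y (\<sigma> g) (\<sigma> h1)"
        | (mixed) h h' where "h \<in> G'" "h' \<in> G'" "X g h" "Y (\<sigma> g) (\<sigma> h')"
        using hh(6) h0 h1 by blast
      then show ?thesis
      proof cases
        case XX
        show ?thesis
          by (rule exchange_via_misplaced_XX[OF sym_Y dist2]) (use XX edges gg h0e h1e Hgb in auto)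
      next
        case YY
        show ?thesis
          by (rule exchange_via_misplaced_YY[OF sym_Y dist2]) (use YY edges gg h0e h1e Hgb in auto)
      next
        case mixed
        from pq_edge show ?thesis
        proof
          assume "X q p"
          then show ?thesis
            by (intro exchange_via_misplaced_X[OF sym_Y dist[OF mixed(2)]])
              (use mixed edges gg hh[OF mixed(2)] Hah[OF mixed(2)] Hgb in auto)
        next
          assume "Y (\<sigma> q) (\<sigma> p)"
          then have "Y (\<sigma> p) (\<sigma> q)" using Y_comm by blast
          then show ?thesis
            by (intro exchange_via_misplaced_Y[OF sym_Y dist[OF mixed(1)]])
              (use mixed edges gg hh[OF mixed(1)] Hah[OF mixed(1)] Hgb in auto)
        qed
      qed
    qed
    then show ?thesis ..
  qed
qed

text \<open>Strong induction on the number of people of \<open>P\<close> in \<open>B\<close>. Every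
  descent, by one swap of a misplaced pair or by the detour, avoids \<open>a\<close> and
  \<open>b\<close>, so conjugation carries the exchange back to \<open>\<sigma>\<close>.\<close>

lemma exchange:
  assumes "\<sigma> permutes A \<union> B" "a \<in> A" "b \<in> B" "X a b" "\<sigma> a \<in> P" "\<sigma> b \<in> Q"
  shows "reach X Y \<sigma> (\<sigma> \<circ> transpose a b)"
  using assms(1,5,6)
proof (induction "card {y \<in> B. \<sigma> y \<in> P}" arbitrary: \<sigma> rule: less_induct)
  case less
  note \<sigma> = less.prems(1)
  let ?X = "\<lambda>x y. X x y \<and> x \<notin> {a, b} \<and> y \<notin> {a, b}"
  have descend: ?case
    if "\<tau> permutes A \<union> B" "\<tau> a \<in> P" "\<tau> b \<in> Q" "reach ?X Y \<sigma> \<tau>"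
      "card {y \<in> B. \<tau> y \<in> P} < card {y \<in> B. \<sigma> y \<in> P}" for \<tau>
    using reach_conjugate[OF sym_Y that(4)] less.hyps[OF that(5,1-3)] by blast
  have PQ: "x \<notin> Q" if "x \<in> P" for x using that disjoint by auto
  show ?case
  proof (cases "\<exists>p \<in> B. \<sigma> p \<in> P")
    case False
    then have "{y \<in> B. \<sigma> y \<in> P} = {}" by blast
    then have "card {x \<in> A. \<sigma> x \<in> P} = card A"
      using card_classes(1)[OF \<sigma> refl] cards by (simp only: card.empty add_0_right)
    then have "{x \<in> A. \<sigma> x \<in> P} = A" using finite by (intro card_subset_eq) auto
    moreover have "\<sigma> ` B \<subseteq> Q"
      using False permutes_in_image[OF \<sigma>] same_union by blast
    ultimately show ?thesis
      by (intro exchange_if_straight \<sigma> assms(2-4)) auto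
  next
    case True
    then obtain p0 where p0: "p0 \<in> B" "\<sigma> p0 \<in> P" by blast
    then have "0 < card {y \<in> B. \<sigma> y \<in> P}" using finite by (auto simp: card_gt_0_iff)
    then have "0 < card {x \<in> A. \<sigma> x \<in> Q}" using card_classes(2)[OF \<sigma> refl] by simp
    then obtain q0 where q0: "q0 \<in> A" "\<sigma> q0 \<in> Q" by (auto simp: card_gt_0_iff)
    show ?thesis
    proof (cases "\<exists>p q. p \<in> B \<and> \<sigma> p \<in> P \<and> q \<in> A \<and> \<sigma> q \<in> Q \<and> X p q \<and> Y (\<sigma> p) (\<sigma> q)")
      case True
      then obtain p q where pq: "p \<in> B" "\<sigma> p \<in> P" "q \<in> A" "\<sigma> q \<in> Q" "X p q" "Y (\<sigma> p) (\<sigma> q)"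
        by blast
      have ne: "p \<noteq> a" "p \<noteq> b" "q \<noteq> a" "q \<noteq> b" "p \<noteq> q"
        using pq assms(2,3) less.prems PQ disjoint by auto
      let ?\<tau> = "\<sigma> \<circ> transpose p q"
      have "{y \<in> B. ?\<tau> y \<in> P} \<subseteq> {y \<in> B. \<sigma> y \<in> P} - {p}"
        using pq disjoint PQ by (auto simp: transpose_def split: if_splits)
      then have "{y \<in> B. ?\<tau> y \<in> P} \<subset> {y \<in> B. \<sigma> y \<in> P}" using pq by blast
      then have "card {y \<in> B. ?\<tau> y \<in> P} < card {y \<in> B. \<sigma> y \<in> P}"
        using finite by (intro psubset_card_mono) auto
      then show ?thesis
        by (intro descend[of ?\<tau>] permutes_comp_transpose \<sigma> reachI)
          (use pq ne ne[symmetric] less.prems in auto)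
    next
      case False
      then show ?thesis
        using exchange_or_straighten[OF \<sigma> assms(2-4) less.prems(2,3) p0 q0] descend by blast
    qed
  qed
qed

end

section \<open>Replacing both graphs by complete bipartite ones\<close>

definition cross :: "'a set \<Rightarrow> 'a set \<Rightarrow> 'a \<Rightarrow> 'a \<Rightarrow> bool" where
  "cross A B x y \<longleftrightarrow> x \<in> A \<and> y \<in> B \<or> x \<in> B \<and> y \<in> A"

lemma symp_cross: "symp (cross A B)"
  by (auto simp: cross_def intro!: sympI)

lemma reach_permutes:
  assumes "reach X Y \<sigma> \<tau>" "\<sigma> permutes S" "\<And>x y. X x y \<Longrightarrow> x \<in> S \<and> y \<in> S"
  shows "\<tau> permutes S"
  using assms(1,2)
proof (induction rule: rtranclp_induct)
  case (step \<tau> \<tau>')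
  then show ?case using assms(3)
    unfolding swap_step_def by (blast intro: permutes_compose permutes_swap_id)
qed

lemma inv_comp_transpose:
  assumes "bij \<sigma>"
  shows "inv (\<sigma> \<circ> transpose a b) = inv \<sigma> \<circ> transpose (\<sigma> a) (\<sigma> b)"
proof -
  have "inv (\<sigma> \<circ> transpose a b) = transpose a b \<circ> inv \<sigma>"
    using assms by (simp add: o_inv_distrib inv_transpose_eq)
  also have "\<dots> = inv \<sigma> \<circ> transpose (\<sigma> a) (\<sigma> b)"
  proof
    fix x
    obtain y where "x = \<sigma> y" using assms by (meson bij_pointE)
    then show "(transpose a b \<circ> inv \<sigma>) x = (inv \<sigma> \<circ> transpose (\<sigma> a) (\<sigma> b)) x"
      using assms by (auto simp: bij_is_inj transpose_def inj_eq)
  qed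
  finally show ?thesis .
qed

text \<open>Inversion exchanges positions and people: swapping the occupants of \<open>a\<close> and
  \<open>b\<close> amounts, for the inverse, to swapping the values at the people
  \<open>\<sigma> a\<close> and \<open>\<sigma> b\<close>.\<close>

lemma reach_inv:
  assumes "reach X Y \<sigma> \<tau>" "\<sigma> permutes S" "\<And>x y. X x y \<Longrightarrow> x \<in> S \<and> y \<in> S"
  shows "reach Y X (inv \<sigma>) (inv \<tau>)"
  using assms(1,2)
proof (induction rule: converse_rtranclp_induct)
  case (step \<sigma> \<sigma>')
  from step.hyps(1) obtain a b where ab: "X a b" "Y (\<sigma> a) (\<sigma> b)" "\<sigma>' = \<sigma> \<circ> transpose a b"
    unfolding swap_step_def by blast
  have bij: "bij \<sigma>" using step.prems by (rule permutes_bij)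
  have "swap_step Y X (inv \<sigma>) (inv \<sigma>')"
    unfolding ab(3) inv_comp_transpose[OF bij]
    using ab bij by (intro swap_stepI) (simp_all add: bij_is_inj)
  moreover have "\<sigma>' permutes S" using reach_permutes[OF _ step.prems assms(3)] step.hyps(1) by blast
  ultimately show ?case using step.IH by (meson converse_rtranclp_into_rtranclp)
qed simp

text \<open>Every swap permitted by \<open>cross A B\<close> exchanges people of different parts at
  adjacent positions, so \<open>exchange\<close> turns it into a path along actual
  friendships.\<close>

lemma reach_complete_right:
  assumes "dense_pair A B A B X Y \<alpha> \<beta> m r"
    and X: "\<And>x y. X x y \<Longrightarrow> cross A B x y"
    and "reach X (cross A B) \<sigma> \<tau>" "\<sigma> permutes A \<union> B"
  shows "reach X Y \<sigma> \<tau>"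
  using assms(3,4)
proof (induction rule: rtranclp_induct)
  case (step \<tau> \<tau>')
  interpret dense_pair A B A B X Y \<alpha> \<beta> m r by fact
  \<comment> \<open>This instance treats the swaps in which the position in \<open>A\<close> is
    occupied by somebody from \<open>B\<close>.\<close>
  interpret swapped: dense_pair A B B A X Y \<alpha> \<beta> m r
    using finite disjoint cards sym_X sym_Y missing_X missing_Y bound
    by unfold_locales (auto simp: Int_commute)
  have \<tau>: "\<tau> permutes A \<union> B"
    using reach_permutes[OF step.hyps(1) step.prems] X unfolding cross_def by blast
  from step.hyps(2) obtain a b where *: "X a b" "cross A B (\<tau> a) (\<tau> b)" "\<tau>' = \<tau> \<circ> transpose a b"
    unfolding swap_step_def by blast
  have main: "reach X Y \<tau> (\<tau> \<circ> transpose a b)"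
    if "a \<in> A" "b \<in> B" "X a b" "cross A B (\<tau> a) (\<tau> b)" for a b
    using that exchange[OF \<tau>, of a b] swapped.exchange[OF \<tau>, of a b] by (auto simp: cross_def)
  have "reach X Y \<tau> \<tau>'"
  proof (cases "a \<in> A \<and> b \<in> B")
    case True
    then show ?thesis using main[of a b] * by simp
  next
    case False
    then have "b \<in> A" "a \<in> B" using X[OF *(1)] by (auto simp: cross_def)
    moreover have "X b a" using *(1) sym_X by (rule sympD[rotated])
    moreover have "cross A B (\<tau> b) (\<tau> a)" using *(2) by (auto simp: cross_def)
    ultimately have "reach X Y \<tau> (\<tau> \<circ> transpose b a)" by (intro main)
    then show ?thesis using * by (simp add: transpose_commute)
  qed
  with step show ?case by auto
qed simp

text \<open>The completion is undone in one graph at a time: invert, thin out the friendships to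
  \<open>X\<close>, invert back so that \<open>X\<close> becomes the graph of positions, and finally
  thin out the friendships to \<open>Y\<close>.\<close>

lemma reach_complete:
  assumes "dense_pair A B A B X Y \<alpha> \<beta> m r"
    and X: "\<And>x y. X x y \<Longrightarrow> cross A B x y"
    and r: "reach (cross A B) (cross A B) \<sigma> \<tau>" and \<sigma>: "\<sigma> permutes A \<union> B"
  shows "reach X Y \<sigma> \<tau>"
proof (rule reach_complete_right[OF assms(1) X _ \<sigma>])
  interpret dense_pair A B A B X Y \<alpha> \<beta> m r by fact
  have c: "cross A B x y \<Longrightarrow> x \<in> A \<union> B \<and> y \<in> A \<union> B" for x y by (auto simp: cross_def)
  \<comment> \<open>The complete bipartite graph misses no edge between the parts, hence the
    0.\<close>
  have "dense_pair A B A B (cross A B) X 0 \<alpha> m r"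
    using finite disjoint cards sym_X missing_X bound symp_cross
    by unfold_locales (auto simp: cross_def)
  moreover have "reach (cross A B) (cross A B) (inv \<sigma>) (inv \<tau>)"
    by (rule reach_inv[OF r \<sigma> c])
  ultimately have "reach (cross A B) X (inv \<sigma>) (inv \<tau>)"
    using reach_complete_right[of A B "cross A B" X] permutes_inv[OF \<sigma>] by blast
  then have "reach X (cross A B) (inv (inv \<sigma>)) (inv (inv \<tau>))"
    by (rule reach_inv[OF _ _ c]) (use \<sigma> permutes_inv in auto)
  moreover have "\<tau> permutes A \<union> B" using reach_permutes[OF r \<sigma> c] .
  ultimately show "reach X (cross A B) \<sigma> \<tau>" using \<sigma> by (simp add: permutes_inv_inv)
qed

lemma two_elements:
  assumes "2 \<le> card S"
  shows "\<exists>x y. x \<in> S \<and> y \<in> S \<and> x \<noteq> y"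
proof -
  obtain T where "T \<subseteq> S" "card T = 2" using obtain_subset_with_card_n[OF assms] by blast
  moreover from this obtain x y where "T = {x, y}" "x \<noteq> y" by (meson card_2_iff)
  ultimately show ?thesis by blast
qed

section \<open>Complete bipartite graphs\<close>

locale bipartition =
  fixes A B :: "'a set"
  assumes finite: "finite A" "finite B" and disjoint: "A \<inter> B = {}"
    and cards: "card A = card B" "2 \<le> card A"
begin

abbreviation K where "K \<equiv> cross A B"

definition parity :: "('a \<Rightarrow> 'a) \<Rightarrow> bool" where
  "parity \<sigma> \<longleftrightarrow> (evenperm \<sigma> \<longleftrightarrow> even (card {x \<in> A. \<sigma> x \<in> A}))"

lemma K_dest: "K x y \<Longrightarrow> x \<in> A \<union> B \<and> y \<in> A \<union> B"
  by (auto simp: cross_def)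

lemma not_both: "x \<in> A \<Longrightarrow> x \<in> B \<Longrightarrow> False"
  using disjoint by auto

text \<open>A swap composes with a transposition, which flips the sign, and carries exactly one
  person of \<open>A\<close> into or out of \<open>A\<close>, which flips the parity of the
  count.\<close>

lemma parity_reach:
  assumes "reach K K \<sigma> \<tau>" "\<sigma> permutes A \<union> B"
  shows "parity \<tau> \<longleftrightarrow> parity \<sigma>"
  using assms
proof (induction rule: rtranclp_induct)
  case (step \<tau> \<tau>')
  have \<tau>: "\<tau> permutes A \<union> B" using reach_permutes[OF step.hyps(1) step.prems K_dest] .
  have main: "parity (\<tau> \<circ> transpose a b) \<longleftrightarrow> parity \<tau>"
    if ab: "a \<in> A" "b \<in> B" "K (\<tau> a) (\<tau> b)" for a b
  proof -
    have ne: "a \<noteq> b" using ab not_both by blast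
    have "permutation \<tau>" using \<tau> finite by (meson finite_Un permutation_permutes)
    then have ev: "evenperm (\<tau> \<circ> transpose a b) \<longleftrightarrow> \<not> evenperm \<tau>"
      using ne by (simp add: evenperm_comp evenperm_swap permutation_swap_id)
    let ?S = "{x \<in> A. \<tau> x \<in> A}" and ?T = "{x \<in> A. (\<tau> \<circ> transpose a b) x \<in> A}"
    have fin: "finite ?S" "finite ?T" using finite by auto
    from ab(3) consider "\<tau> a \<in> A" "\<tau> b \<in> B" | "\<tau> a \<in> B" "\<tau> b \<in> A" by (auto simp: cross_def)
    then have "even (card ?T) \<longleftrightarrow> odd (card ?S)"
    proof cases
      case 1
      then have "?S = insert a ?T" "a \<notin> ?T"
        using ab not_both by (auto simp: transpose_def split: if_splits)
      then show ?thesis using fin by simp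
    next
      case 2
      then have "?T = insert a ?S" "a \<notin> ?S"
        using ab not_both by (auto simp: transpose_def split: if_splits)
      then show ?thesis using fin by simp
    qed
    then show ?thesis using ev by (auto simp: parity_def)
  qed
  from step.hyps(2) obtain a b where *: "K a b" "K (\<tau> a) (\<tau> b)" "\<tau>' = \<tau> \<circ> transpose a b"
    unfolding swap_step_def by blast
  have "parity \<tau>' \<longleftrightarrow> parity \<tau>"
  proof (cases "a \<in> A \<and> b \<in> B")
    case True
    then show ?thesis using main * by simp
  next
    case False
    then have "b \<in> A" "a \<in> B" using *(1) by (auto simp: cross_def)
    moreover have "K (\<tau> b) (\<tau> a)" using *(2) by (auto simp: cross_def)
    ultimately have "parity (\<tau> \<circ> transpose b a) \<longleftrightarrow> parity \<tau>" by (intro main)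
    then show ?thesis using * by (simp add: transpose_commute)
  qed
  then show ?case using step by simp
qed simp

section \<open>Completeness of the parity invariant\<close>

definition straight :: "('a \<Rightarrow> 'a) \<Rightarrow> bool" where
  "straight \<sigma> \<longleftrightarrow> \<sigma> permutes A \<union> B \<and> \<sigma> ` A \<subseteq> A \<and> \<sigma> ` B \<subseteq> B"

text \<open>There are as many misplaced people in \<open>A\<close> as in \<open>B\<close>, and in
  the complete bipartite graph any two of them at opposite positions can be swapped.\<close>

lemma reach_straight:
  assumes "\<sigma> permutes A \<union> B"
  shows "\<exists>\<tau>. reach K K \<sigma> \<tau> \<and> straight \<tau>"
  using assms
proof (induction "card {y \<in> B. \<sigma> y \<in> A}" arbitrary: \<sigma> rule: less_induct)
  case less
  note \<sigma> = less.prems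
  have cards': "card {x \<in> A. \<sigma> x \<in> B} = card {y \<in> B. \<sigma> y \<in> A}"
  proof -
    have "{x \<in> A. \<sigma> x \<in> A} \<union> {y \<in> B. \<sigma> y \<in> A} = \<sigma> -` A"
      using permutes_in_image[OF \<sigma>] by auto
    moreover have "card (\<sigma> -` A) = card A"
      using permutes_bij[OF \<sigma>] by (intro card_vimage_inj) (auto simp: bij_def)
    moreover have "card ({x \<in> A. \<sigma> x \<in> A} \<union> {y \<in> B. \<sigma> y \<in> A})
        = card {x \<in> A. \<sigma> x \<in> A} + card {y \<in> B. \<sigma> y \<in> A}"
      using finite disjoint by (intro card_Un_disjoint) auto
    moreover have "{x \<in> A. \<not> \<sigma> x \<in> A} = {x \<in> A. \<sigma> x \<in> B}"
      using permutes_in_image[OF \<sigma>] not_both by blast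
    ultimately show ?thesis using card_Collect_split[OF finite(1), of "\<lambda>x. \<sigma> x \<in> A"] by simp
  qed
  show ?case
  proof (cases "\<exists>b \<in> B. \<sigma> b \<in> A")
    case True
    then obtain b where b: "b \<in> B" "\<sigma> b \<in> A" by blast
    then have "0 < card {y \<in> B. \<sigma> y \<in> A}" using finite by (auto simp: card_gt_0_iff)
    then obtain a where a: "a \<in> A" "\<sigma> a \<in> B" unfolding cards'[symmetric] by (auto simp: card_gt_0_iff)
    let ?\<tau> = "\<sigma> \<circ> transpose a b"
    have step: "reach K K \<sigma> ?\<tau>" using a b by (intro reachI) (auto simp: cross_def)
    have "{y \<in> B. ?\<tau> y \<in> A} \<subseteq> {y \<in> B. \<sigma> y \<in> A} - {b}"
      using a b not_both by (auto simp: transpose_def split: if_splits)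
    then have "{y \<in> B. ?\<tau> y \<in> A} \<subset> {y \<in> B. \<sigma> y \<in> A}" using b by blast
    then have "card {y \<in> B. ?\<tau> y \<in> A} < card {y \<in> B. \<sigma> y \<in> A}"
      using finite by (intro psubset_card_mono) auto
    from less.hyps[OF this reach_permutes[OF step \<sigma> K_dest]] step
    show ?thesis by (meson rtranclp_trans)
  next
    case False
    then have "{y \<in> B. \<sigma> y \<in> A} = {}" by blast
    then have "card {x \<in> A. \<sigma> x \<in> B} = 0" using cards' by (simp only: card.empty)
    then have "{x \<in> A. \<sigma> x \<in> B} = {}" using finite by simp
    then have "straight \<sigma>"
      unfolding straight_def using \<sigma> False permutes_in_image[OF \<sigma>] by blast
    then show ?thesis by blast
  qed
qed

text \<open>Transposing such a pair keeps a straight configuration straight, but it is not a single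
  swap, as swaps join opposite parts.\<close>

definition side :: "'a \<Rightarrow> 'a \<Rightarrow> bool" where
  "side x y \<longleftrightarrow> x \<noteq> y \<and> (x \<in> A \<and> y \<in> A \<or> x \<in> B \<and> y \<in> B)"

lemma straight_transpose:
  assumes "straight \<sigma>" "side x y"
  shows "straight (\<sigma> \<circ> transpose x y)"
proof -
  have "\<sigma> \<circ> transpose x y permutes A \<union> B"
    using assms by (intro permutes_compose permutes_swap_id) (auto simp: straight_def side_def)
  moreover have "transpose x y z \<in> A" if "z \<in> A" for z
    using that assms(2) not_both by (cases "z = x"; cases "z = y") (auto simp: side_def)
  moreover have "transpose x y z \<in> B" if "z \<in> B" for z
    using that assms(2) not_both by (cases "z = x"; cases "z = y") (auto simp: side_def)
  ultimately show ?thesis using assms(1) by (simp add: straight_def image_subset_iff)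
qed

text \<open>One swap along each of the four edges of the 4-cycle on these positions, in a suitable
  order, composes to the two transpositions.\<close>

lemma reach_double_transpose:
  assumes \<sigma>: "straight \<sigma>" and "a \<in> A" "a' \<in> A" "a \<noteq> a'" "b \<in> B" "b' \<in> B" "b \<noteq> b'"
  shows "reach K K \<sigma> (\<sigma> \<circ> transpose a a' \<circ> transpose b b')"
proof -
  have im: "\<sigma> a \<in> A" "\<sigma> a' \<in> A" "\<sigma> b \<in> B" "\<sigma> b' \<in> B" using assms by (auto simp: straight_def)
  have ne: "a \<noteq> b" "a \<noteq> b'" "a' \<noteq> b" "a' \<noteq> b'" using assms not_both by blast+
  note ne' = ne ne[symmetric] assms(4,7) assms(4,7)[symmetric]
  let ?s1 = "\<sigma> \<circ> transpose a b" let ?s2 = "?s1 \<circ> transpose a' b'"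
  let ?s3 = "?s2 \<circ> transpose a b'" let ?s4 = "?s3 \<circ> transpose a' b"
  have "swap_step K K \<sigma> ?s1" using im assms by (intro swap_stepI) (auto simp: cross_def)
  moreover have "swap_step K K ?s1 ?s2"
    using im assms ne' by (intro swap_stepI) (auto simp: cross_def transpose_def)
  moreover have "swap_step K K ?s2 ?s3"
    using im assms ne' by (intro swap_stepI) (auto simp: cross_def transpose_def)
  moreover have "swap_step K K ?s3 ?s4"
    using im assms ne' by (intro swap_stepI) (auto simp: cross_def transpose_def)
  moreover have "?s4 = \<sigma> \<circ> transpose a a' \<circ> transpose b b'"
    using ne' by (auto simp: fun_eq_iff transpose_def)
  ultimately show ?thesis by (metis (no_types) rtranclp.rtrancl_into_rtrancl rtranclp.rtrancl_refl)
qed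

lemma reach_K_sym: "reach K K \<sigma> \<tau> \<Longrightarrow> reach K K \<tau> \<sigma>"
  by (rule reach_sym[OF symp_cross])

text \<open>For pairs in opposite parts, apply the double transposition after the first
  transposition, which then cancels. Pairs in the same part are compared through a pair in the other
  part.\<close>

lemma reach_transposes:
  assumes \<sigma>: "straight \<sigma>" and s: "side x y" "side x' y'"
  shows "reach K K (\<sigma> \<circ> transpose x y) (\<sigma> \<circ> transpose x' y')"
proof -
  have opp: "reach K K (\<sigma> \<circ> transpose x y) (\<sigma> \<circ> transpose x' y')"
    if "x \<in> A" "y \<in> A" "x \<noteq> y" "x' \<in> B" "y' \<in> B" "x' \<noteq> y'" for x y x' y'
  proof -
    have "straight (\<sigma> \<circ> transpose x y)" using that by (intro straight_transpose \<sigma>) (auto simp: side_def)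
    then have "reach K K (\<sigma> \<circ> transpose x y) (\<sigma> \<circ> transpose x y \<circ> transpose x y \<circ> transpose x' y')"
      using that by (intro reach_double_transpose)
    then show ?thesis by (simp add: comp_assoc)
  qed
  obtain a a' where a: "a \<in> A" "a' \<in> A" "a \<noteq> a'" using two_elements[of A] cards by auto
  obtain b b' where b: "b \<in> B" "b' \<in> B" "b \<noteq> b'" using two_elements[of B] cards by auto
  have to_b: "reach K K (\<sigma> \<circ> transpose x y) (\<sigma> \<circ> transpose b b')" if "side x y" for x y
  proof (cases "x \<in> A \<and> y \<in> A")
    case True
    then show ?thesis using that b by (intro opp) (auto simp: side_def)
  next
    case False
    then have "reach K K (\<sigma> \<circ> transpose a a') (\<sigma> \<circ> transpose x y)"
      using that a by (intro opp) (auto simp: side_def)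
    moreover have "reach K K (\<sigma> \<circ> transpose a a') (\<sigma> \<circ> transpose b b')"
      using a b by (intro opp)
    ultimately show ?thesis by (meson reach_K_sym rtranclp_trans)
  qed
  show ?thesis using to_b[OF s(1)] reach_K_sym[OF to_b[OF s(2)]] by (rule rtranclp_trans)
qed

text \<open>Transpositions within the parts are interchangeable up to reachability, so only the
  parity of their number counts. The induction splits off transpositions on the left of
  \<open>p\<close>, next to \<open>\<sigma>\<close>, and therefore needs all straight
  \<open>\<sigma>\<close> at once.\<close>

lemma reach_side_permutation:
  assumes "p permutes S" and S: "S = A \<or> S = B" and \<sigma>: "straight \<sigma>" and xy: "side x y"
  shows "reach K K (if evenperm p then \<sigma> else \<sigma> \<circ> transpose x y) (\<sigma> \<circ> p)"
proof -
  have fin: "finite S" using S finite by auto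
  from assms(1) this have "straight \<sigma> \<longrightarrow>
      reach K K (if evenperm p then \<sigma> else \<sigma> \<circ> transpose x y) (\<sigma> \<circ> p)" for \<sigma>
  proof (induction arbitrary: \<sigma> rule: permutes_induct)
    case id
    then show ?case by (simp add: evenperm_id)
  next
    case (swap c d p)
    have cd: "side c d" using swap.hyps S by (auto simp: side_def)
    have "permutation p" using swap.hyps fin by (auto simp: permutation_permutes)
    then have ev: "evenperm (transpose c d \<circ> p) \<longleftrightarrow> \<not> evenperm p"
      using swap.hyps by (simp add: evenperm_comp evenperm_swap permutation_swap_id)
    show ?case
    proof
      assume \<sigma>: "straight \<sigma>"
      let ?\<sigma> = "\<sigma> \<circ> transpose c d"
      have \<sigma>': "straight ?\<sigma>" using \<sigma> cd by (rule straight_transpose)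
      have IH: "reach K K (if evenperm p then ?\<sigma> else ?\<sigma> \<circ> transpose x y) (\<sigma> \<circ> (transpose c d \<circ> p))"
        using swap.IH[of ?\<sigma>] \<sigma>' by (simp add: comp_def)
      show "reach K K (if evenperm (transpose c d \<circ> p) then \<sigma> else \<sigma> \<circ> transpose x y)
          (\<sigma> \<circ> (transpose c d \<circ> p))"
      proof (cases "evenperm p")
        case True
        then show ?thesis using IH ev reach_transposes[OF \<sigma> xy cd] by simp
      next
        case False
        have "reach K K (?\<sigma> \<circ> transpose c d) (?\<sigma> \<circ> transpose x y)"
          by (rule reach_transposes[OF \<sigma>' cd xy])
        then show ?thesis using IH ev False by (simp add: comp_assoc)
      qed
    qed
  qed
  then show ?thesis using \<sigma> by blast
qed

lemma permutation_on: "\<sigma> permutes A \<union> B \<Longrightarrow> permutation \<sigma>"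
  using finite by (meson finite_Un permutation_permutes)

text \<open>The quotient of the two configurations preserves both parts, so it factors into a
  permutation of \<open>A\<close> and one of \<open>B\<close>. It is even, so the factors have equal
  parity.\<close>

lemma reach_straight_even:
  assumes \<sigma>: "straight \<sigma>" and \<tau>: "straight \<tau>" and ev: "evenperm \<sigma> \<longleftrightarrow> evenperm \<tau>"
  shows "reach K K \<sigma> \<tau>"
proof -
  have perm: "\<sigma> permutes A \<union> B" "\<tau> permutes A \<union> B" using \<sigma> \<tau> by (auto simp: straight_def)
  define \<pi> where "\<pi> = inv \<sigma> \<circ> \<tau>"
  have \<pi>: "\<pi> permutes A \<union> B" unfolding \<pi>_def using perm by (simp add: permutes_compose permutes_inv)
  have part: "\<pi> ` S = S" if "S = A \<or> S = B" for S
  proof -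
    have "finite S" using that finite by auto
    moreover have "inj_on \<sigma> S" "inj_on \<tau> S" using perm by (meson permutes_inj inj_on_subset subset_UNIV)+
    moreover have "\<sigma> ` S \<subseteq> S" "\<tau> ` S \<subseteq> S" using \<sigma> \<tau> that by (auto simp: straight_def)
    ultimately have "\<sigma> ` S = S" "\<tau> ` S = S" by (simp_all add: endo_inj_surj)
    then have "\<pi> ` S = inv \<sigma> ` (\<sigma> ` S)" by (simp only: \<pi>_def image_comp[symmetric])
    also have "\<dots> = S" by (rule image_inv_f_f[OF permutes_inj[OF perm(1)]])
    finally show ?thesis .
  qed
  define p where "p S x = (if x \<in> S then \<pi> x else x)" for S x
  have p: "p S permutes S" if "S = A \<or> S = B" for S
  proof (rule bij_imp_permutes)
    have "inj_on \<pi> S" using \<pi> by (meson permutes_inj inj_on_subset subset_UNIV)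
    then have "bij_betw \<pi> S S" using part[OF that] by (simp add: bij_betw_def)
    then show "bij_betw (p S) S S" by (rule bij_betw_cong[THEN iffD1, rotated]) (simp add: p_def)
  qed (simp add: p_def)
  have \<pi>_eq: "\<pi> = p A \<circ> p B"
  proof
    fix x
    show "\<pi> x = (p A \<circ> p B) x"
    proof (cases "x \<in> B")
      case True
      then have "\<pi> x \<in> B" using part[of B] by blast
      then show ?thesis using True not_both by (auto simp: p_def)
    next
      case False
      then show ?thesis using permutes_not_in[OF \<pi>] by (auto simp: p_def)
    qed
  qed
  have \<tau>_eq: "\<tau> = \<sigma> \<circ> p A \<circ> p B"
    unfolding comp_assoc \<pi>_eq[symmetric] \<pi>_def using perm(1)
    by (simp add: comp_assoc[symmetric] permutes_inv_o)
  have permut: "permutation (p A)" "permutation (p B)" using p finite by (auto simp: permutation_permutes)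
  have "evenperm \<pi>"
    unfolding \<pi>_def using ev perm
    by (simp add: evenperm_comp evenperm_inv permutation_on permutation_inverse)
  then have evAB: "evenperm (p A) \<longleftrightarrow> evenperm (p B)"
    unfolding \<pi>_eq using permut by (simp add: evenperm_comp)
  obtain x y where xy: "x \<in> A" "y \<in> A" "x \<noteq> y"
    using two_elements[OF cards(2)] by blast
  then have side: "side x y" by (simp add: side_def)
  have "straight (\<sigma> \<circ> p A)"
  proof -
    have "p A permutes A \<union> B" using p[of A] by (auto intro: permutes_subset)
    then have "\<sigma> \<circ> p A permutes A \<union> B" using perm(1) by (rule permutes_compose)
    moreover have "p A x \<in> A" if "x \<in> A" for x using permutes_in_image[OF p[of A]] that by simp
    moreover have "p A x = x" if "x \<in> B" for x using that not_both by (auto simp: p_def)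
    ultimately show ?thesis
      using \<sigma> by (simp add: straight_def image_subset_iff)
  qed
  then have 1: "reach K K (if evenperm (p B) then \<sigma> \<circ> p A else \<sigma> \<circ> p A \<circ> transpose x y) \<tau>"
    unfolding \<tau>_eq by (intro reach_side_permutation[OF p _ _ side]) auto
  show ?thesis
  proof (cases "evenperm (p A)")
    case True
    then have "reach K K \<sigma> (\<sigma> \<circ> p A)"
      using reach_side_permutation[OF p[of A] _ \<sigma> side] by simp
    also have "reach K K (\<sigma> \<circ> p A) \<tau>" using 1 evAB True by simp
    finally (rtranclp_trans) show ?thesis .
  next
    case False
    \<comment> \<open>With both factors odd, an additional transposition makes the first one even;
      the same transposition is the starting point for the odd second factor.\<close>
    have "p A \<circ> transpose x y permutes A" using p[of A] xy by (auto intro: permutes_compose permutes_swap_id)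
    moreover have "evenperm (p A \<circ> transpose x y)"
      using False xy permut by (simp add: evenperm_comp evenperm_swap permutation_swap_id)
    ultimately have "reach K K \<sigma> (\<sigma> \<circ> p A \<circ> transpose x y)"
      using reach_side_permutation[OF _ _ \<sigma> side, of "p A \<circ> transpose x y" A] by (simp add: comp_assoc)
    also have "reach K K (\<sigma> \<circ> p A \<circ> transpose x y) \<tau>" using 1 evAB False by simp
    finally (rtranclp_trans) show ?thesis .
  qed
qed

text \<open>Both configurations can be straightened. On straight ones the count is |A|, so the
  invariant determines the sign.\<close>

lemma reach_iff_parity:
  assumes "\<sigma> permutes A \<union> B" "\<tau> permutes A \<union> B"
  shows "reach K K \<sigma> \<tau> \<longleftrightarrow> (parity \<sigma> \<longleftrightarrow> parity \<tau>)"
proof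
  assume "reach K K \<sigma> \<tau>"
  from parity_reach[OF this assms(1)] show "parity \<sigma> \<longleftrightarrow> parity \<tau>" by blast
next
  assume par: "parity \<sigma> \<longleftrightarrow> parity \<tau>"
  obtain \<sigma>' where \<sigma>': "reach K K \<sigma> \<sigma>'" "straight \<sigma>'" using reach_straight assms by blast
  obtain \<tau>' where \<tau>': "reach K K \<tau> \<tau>'" "straight \<tau>'" using reach_straight assms by blast
  have "{x \<in> A. \<rho> x \<in> A} = A" if "straight \<rho>" for \<rho> using that by (auto simp: straight_def)
  then have "parity \<rho> \<longleftrightarrow> (evenperm \<rho> \<longleftrightarrow> even (card A))" if "straight \<rho>" for \<rho>
    using that by (simp add: parity_def)
  then have "evenperm \<sigma>' \<longleftrightarrow> evenperm \<tau>'"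
    using par parity_reach[OF \<sigma>'(1) assms(1)] parity_reach[OF \<tau>'(1) assms(2)] \<sigma>'(2) \<tau>'(2)
    by blast
  then have "reach K K \<sigma>' \<tau>'" using reach_straight_even \<sigma>' \<tau>' by blast
  then show "reach K K \<sigma> \<tau>" using \<sigma>'(1) reach_K_sym[OF \<tau>'(1)] by (meson rtranclp_trans)
qed

text \<open>A transposition within \<open>A\<close> flips the sign and keeps the count; it is
  applied to the identity.\<close>

lemma both_parities:
  shows "\<exists>\<sigma>. \<sigma> permutes A \<union> B \<and> parity \<sigma>" "\<exists>\<sigma>. \<sigma> permutes A \<union> B \<and> \<not> parity \<sigma>"
proof -
  have par: "parity (\<sigma> \<circ> transpose x y) \<longleftrightarrow> \<not> parity \<sigma>"
    if "\<sigma> permutes A \<union> B" "x \<in> A" "y \<in> A" "x \<noteq> y" for \<sigma> x y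
  proof -
    have "{z \<in> A. (\<sigma> \<circ> transpose x y) z \<in> A} = transpose x y ` {z \<in> A. \<sigma> z \<in> A}"
      using that by (auto simp: image_iff transpose_def split: if_splits)
    then have "card {z \<in> A. (\<sigma> \<circ> transpose x y) z \<in> A} = card {z \<in> A. \<sigma> z \<in> A}"
      by (simp add: card_image)
    moreover have "evenperm (\<sigma> \<circ> transpose x y) \<longleftrightarrow> \<not> evenperm \<sigma>"
      using that permutation_on by (simp add: evenperm_comp evenperm_swap permutation_swap_id)
    ultimately show ?thesis by (auto simp: parity_def)
  qed
  obtain x y where xy: "x \<in> A" "y \<in> A" "x \<noteq> y"
    using two_elements[OF cards(2)] by blast
  have id: "id permutes A \<union> B" by (rule permutes_id)
  moreover have "id \<circ> transpose x y permutes A \<union> B"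
    using xy by (intro permutes_compose permutes_swap_id id) auto
  ultimately show "\<exists>\<sigma>. \<sigma> permutes A \<union> B \<and> parity \<sigma>" "\<exists>\<sigma>. \<sigma> permutes A \<union> B \<and> \<not> parity \<sigma>"
    using par[OF id xy] by blast+
qed

end

section \<open>Components of the friends-and-strangers graph\<close>

text \<open>The components correspond to their vertex sets, which are the classes of mutual
  reachability, and \<open>I\<close> separates these into two nonempty classes.\<close>

lemma card_connected_components_2:
  assumes "pair_graph G"
    and reachable: "\<And>u v. u \<in> pverts G \<Longrightarrow> v \<in> pverts G \<Longrightarrow> u \<rightarrow>\<^sup>*\<^bsub>with_proj G\<^esub> v \<longleftrightarrow> (I u \<longleftrightarrow> I v)"
    and "u \<in> pverts G" "I u" "v \<in> pverts G" "\<not> I v"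
  shows "card (connected_components G) = 2"
proof -
  interpret pair_graph G by fact
  interpret graph "with_proj G" by unfold_locales
  have scc: "pre_digraph.scc_of (with_proj G) w = {z \<in> pverts G. I z \<longleftrightarrow> I w}" if "w \<in> pverts G" for w
  proof (intro set_eqI iffI)
    fix z assume "z \<in> pre_digraph.scc_of (with_proj G) w"
    then have "w \<rightarrow>\<^sup>*\<^bsub>with_proj G\<^esub> z" by (simp add: scc_of_def)
    moreover from this have "z \<in> pverts G" by (rule reachable_in_verts(2))
    ultimately show "z \<in> {z \<in> pverts G. I z \<longleftrightarrow> I w}" using reachable[OF that] by simp
  next
    fix z assume "z \<in> {z \<in> pverts G. I z \<longleftrightarrow> I w}"
    then show "z \<in> pre_digraph.scc_of (with_proj G) w"
      using reachable[OF that] reachable[OF _ that] by (simp add: scc_of_def)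
  qed
  have "pre_digraph.sccs_verts (with_proj G) = {{z \<in> pverts G. I z}, {z \<in> pverts G. \<not> I z}}"
  proof -
    have "pre_digraph.sccs_verts (with_proj G) = (\<lambda>w. {z \<in> pverts G. I z \<longleftrightarrow> I w}) ` pverts G"
      unfolding sccs_verts_conv_scc_of using scc by (intro image_cong) simp_all
    also have "\<dots> = {{z \<in> pverts G. I z}, {z \<in> pverts G. \<not> I z}}" (is "?f ` _ = {?S, ?T}")
    proof (intro equalityI subsetI)
      fix C assume "C \<in> ?f ` pverts G"
      then obtain w where "C = ?f w" by blast
      then show "C \<in> {?S, ?T}" by (cases "I w") simp_all
    next
      fix C assume "C \<in> {?S, ?T}"
      then have "C = ?f u \<or> C = ?f v" using assms by simp
      then show "C \<in> ?f ` pverts G" using assms by blast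
    qed
    finally show ?thesis .
  qed
  moreover have "{z \<in> pverts G. I z} \<noteq> {z \<in> pverts G. \<not> I z}" using assms by blast
  ultimately have "card (pre_digraph.sccs_verts (with_proj G)) = 2" by simp
  then show ?thesis using connected_components_eq_sccs[OF assms(1)] card_sccs_verts by simp
qed

text \<open>A vertex of \<open>FS\<close> is undefined outside \<open>V\<close>, while a permutation
  is the identity there. This map and \<open>restrict\<close> translate between the two
  forms.\<close>

definition extend_id :: "'a set \<Rightarrow> ('a \<Rightarrow> 'a) \<Rightarrow> 'a \<Rightarrow> 'a" where
  "extend_id V \<sigma> x = (if x \<in> V then \<sigma> x else x)"

lemma extend_id_permutes: "bij_betw \<sigma> V V \<Longrightarrow> extend_id V \<sigma> permutes V"
  by (rule bij_imp_permutes) (auto simp: extend_id_def cong: bij_betw_cong)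

lemma restrict_bij: "p permutes V \<Longrightarrow> bij_betw (restrict p V) V V"
  using permutes_imp_bij by (simp cong: bij_betw_cong)

lemma extend_id_restrict: "p permutes V \<Longrightarrow> extend_id V (restrict p V) = p"
  by (auto simp: extend_id_def fun_eq_iff permutes_not_in)

lemma restrict_extend_id: "\<sigma> \<in> extensional V \<Longrightarrow> restrict (extend_id V \<sigma>) V = \<sigma>"
  by (auto simp: extend_id_def fun_eq_iff extensional_def)

lemma pverts_FS:
  "pverts (FS X Y) = {\<sigma> \<in> extensional (pverts X). bij_betw \<sigma> (pverts X) (pverts Y)}"
  by (simp add: FS_def Let_def)

text \<open>On \<open>V\<close> the pointwise conditions on an arc say that \<open>\<tau>\<close> is
  \<open>\<sigma>\<close> after a transposition. Outside \<open>V\<close> both extensions are the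
  identity, and the transposition acts trivially because its two positions lie in
  \<open>V\<close>.\<close>

lemma arc_FS_iff:
  assumes V: "pverts X = V" "pverts Y = V" and "pair_graph X"
    and \<sigma>: "\<sigma> \<in> pverts (FS X Y)" and \<tau>: "\<tau> \<in> pverts (FS X Y)"
  shows "(\<sigma>, \<tau>) \<in> parcs (FS X Y) \<longleftrightarrow>
    swap_step (\<lambda>x y. (x, y) \<in> parcs X) (\<lambda>x y. (x, y) \<in> parcs Y) (extend_id V \<sigma>) (extend_id V \<tau>)"
proof -
  interpret pair_graph X by fact
  have in_V: "x \<in> V" "y \<in> V" if "(x, y) \<in> parcs X" for x y
    using in_arcsD1[OF that] in_arcsD2[OF that] V by auto
  have step: "\<sigma> a = \<tau> b \<and> \<sigma> b = \<tau> a \<and> (\<forall>c \<in> V - {a, b}. \<sigma> c = \<tau> c) \<longleftrightarrow>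
      extend_id V \<tau> = extend_id V \<sigma> \<circ> transpose a b" if "a \<in> V" "b \<in> V" for a b
  proof
    assume *: "\<sigma> a = \<tau> b \<and> \<sigma> b = \<tau> a \<and> (\<forall>c \<in> V - {a, b}. \<sigma> c = \<tau> c)"
    show "extend_id V \<tau> = extend_id V \<sigma> \<circ> transpose a b"
    proof
      fix x
      show "extend_id V \<tau> x = (extend_id V \<sigma> \<circ> transpose a b) x"
        using * that by (cases "x = a"; cases "x = b") (simp_all add: extend_id_def)
    qed
  next
    assume "extend_id V \<tau> = extend_id V \<sigma> \<circ> transpose a b"
    then have *: "extend_id V \<tau> x = extend_id V \<sigma> (transpose a b x)" for x by simp
    show "\<sigma> a = \<tau> b \<and> \<sigma> b = \<tau> a \<and> (\<forall>c \<in> V - {a, b}. \<sigma> c = \<tau> c)"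
    proof (intro conjI ballI)
      show "\<sigma> a = \<tau> b" "\<sigma> b = \<tau> a" using *[of a] *[of b] that by (simp_all add: extend_id_def)
      show "\<sigma> c = \<tau> c" if "c \<in> V - {a, b}" for c using *[of c] that by (simp add: extend_id_def)
    qed
  qed
  have "(\<exists>a b. (a, b) \<in> parcs X \<and> (\<sigma> a, \<sigma> b) \<in> parcs Y \<and>
          \<sigma> a = \<tau> b \<and> \<sigma> b = \<tau> a \<and> (\<forall>c \<in> V - {a, b}. \<sigma> c = \<tau> c)) \<longleftrightarrow>
      (\<exists>a b. (a, b) \<in> parcs X \<and> (extend_id V \<sigma> a, extend_id V \<sigma> b) \<in> parcs Y \<and>
          extend_id V \<tau> = extend_id V \<sigma> \<circ> transpose a b)"
  proof (intro ex_cong1 conj_cong[OF refl])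
    fix a b assume "(a, b) \<in> parcs X"
    then have ab: "a \<in> V" "b \<in> V" using in_V by blast+
    show "((\<sigma> a, \<sigma> b) \<in> parcs Y \<and> \<sigma> a = \<tau> b \<and> \<sigma> b = \<tau> a \<and> (\<forall>c \<in> V - {a, b}. \<sigma> c = \<tau> c)) \<longleftrightarrow>
        ((extend_id V \<sigma> a, extend_id V \<sigma> b) \<in> parcs Y \<and> extend_id V \<tau> = extend_id V \<sigma> \<circ> transpose a b)"
      unfolding step[OF ab] using ab by (simp only: extend_id_def if_True)
  qed
  moreover have "(\<sigma>, \<tau>) \<in> parcs (FS X Y) \<longleftrightarrow> (\<exists>a b. (a, b) \<in> parcs X \<and> (\<sigma> a, \<sigma> b) \<in> parcs Y \<and>
          \<sigma> a = \<tau> b \<and> \<sigma> b = \<tau> a \<and> (\<forall>c \<in> V - {a, b}. \<sigma> c = \<tau> c))"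
    using \<sigma> \<tau> V by (simp add: FS_def Let_def)
  ultimately show ?thesis unfolding swap_step_def by simp
qed

lemma reachable_FS_iff:
  assumes V: "pverts X = V" "pverts Y = V" and X: "pair_graph X" and Y: "pair_graph Y"
    and \<sigma>: "\<sigma> \<in> pverts (FS X Y)" and \<tau>: "\<tau> \<in> pverts (FS X Y)"
  shows "\<sigma> \<rightarrow>\<^sup>*\<^bsub>with_proj (FS X Y)\<^esub> \<tau> \<longleftrightarrow>
    reach (\<lambda>x y. (x, y) \<in> parcs X) (\<lambda>x y. (x, y) \<in> parcs Y) (extend_id V \<sigma>) (extend_id V \<tau>)"
    (is "_ \<longleftrightarrow> reach ?X ?Y _ _")
proof -
  interpret X: pair_graph X by fact
  interpret FS: pair_graph "FS X Y" using pair_graph_FS X Y .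
  have in_V: "?X x y \<Longrightarrow> x \<in> V \<and> y \<in> V" for x y
    using X.in_arcsD1[of x y] X.in_arcsD2[of x y] V by auto
  show ?thesis
  proof
    assume "\<sigma> \<rightarrow>\<^sup>*\<^bsub>with_proj (FS X Y)\<^esub> \<tau>"
    then show "reach ?X ?Y (extend_id V \<sigma>) (extend_id V \<tau>)"
    proof (induction rule: FS.reachable_induct)
      case base
      then show ?case by simp
    next
      case (step \<tau> \<tau>')
      have "(\<tau>, \<tau>') \<in> parcs (FS X Y)" using step.hyps(2) by simp
      moreover from this have "\<tau> \<in> pverts (FS X Y)" "\<tau>' \<in> pverts (FS X Y)"
        using FS.in_arcsD1[of \<tau> \<tau>'] FS.in_arcsD2[of \<tau> \<tau>'] by simp_all
      ultimately have "swap_step ?X ?Y (extend_id V \<tau>) (extend_id V \<tau>')"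
        using arc_FS_iff[OF V X, of \<tau> \<tau>'] by simp
      with step.IH show ?case by (rule rtranclp.rtrancl_into_rtrancl[of "swap_step ?X ?Y"])
    qed
  next
    have vert: "restrict p V \<in> pverts (FS X Y)" if "p permutes V" for p
      using restrict_bij[OF that] V by (simp only: pverts_FS mem_Collect_eq restrict_extensional simp_thms)
    have perm: "extend_id V \<sigma> permutes V" if "\<sigma> \<in> pverts (FS X Y)" for \<sigma>
      using that V by (simp add: pverts_FS extend_id_permutes)
    \<comment> \<open>Stated for permutations, because the intermediate configurations arise as
      such; each is restricted to become a vertex.\<close>
    have path: "restrict (extend_id V \<sigma>) V \<rightarrow>\<^sup>*\<^bsub>with_proj (FS X Y)\<^esub> restrict p V"
      if "reach ?X ?Y (extend_id V \<sigma>) p" for p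
      using that
    proof (induction rule: rtranclp_induct)
      case base
      show ?case using vert[OF perm[OF \<sigma>]] by (intro FS.reachable_refl)
    next
      case (step p p')
      have p: "p permutes V" by (rule reach_permutes[OF step.hyps(1) perm[OF \<sigma>] in_V])
      have p': "p' permutes V" by (rule reach_permutes[OF r_into_rtranclp[of "swap_step ?X ?Y"] p in_V]) (fact step.hyps)
      have "(restrict p V, restrict p' V) \<in> parcs (FS X Y)"
        using arc_FS_iff[OF V X vert[OF p] vert[OF p']] step.hyps(2) p p' by (simp add: extend_id_restrict)
      with step.IH show ?case by (rule FS.reachable_adj_trans)
    qed
    have restrict: "restrict (extend_id V \<rho>) V = \<rho>" if "\<rho> \<in> pverts (FS X Y)" for \<rho>
      using that V by (intro restrict_extend_id) (simp add: pverts_FS)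
    assume "reach ?X ?Y (extend_id V \<sigma>) (extend_id V \<tau>)"
    from path[OF this] show "\<sigma> \<rightarrow>\<^sup>*\<^bsub>with_proj (FS X Y)\<^esub> \<tau>"
      unfolding restrict[OF \<sigma>] restrict[OF \<tau>] .
  qed
qed

section \<open>From minimum degrees to missing edges, and the count of components\<close>

lemma symp_parcs:
  assumes "pair_graph G"
  shows "symp (\<lambda>x y. (x, y) \<in> parcs G)"
proof -
  interpret pair_graph G by fact
  show ?thesis using graph_symmetric by (intro sympI) simp
qed

text \<open>All arcs at \<open>x\<close> lead into \<open>W\<close>, so its out-degree counts
  neighbours in \<open>W\<close>, and the rest of the r elements of \<open>W\<close> are
  missing.\<close>

lemma missing_le:
  assumes "edge_subgraph X K" and K: "pverts K = U \<union> W" "U \<inter> W = {}" "parcs K = U \<times> W \<union> W \<times> U"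
    and fin: "finite U" "finite W" and r: "card U = r" "card W = r" and x: "x \<in> U"
  shows "min_degree X \<le> r" "card {y \<in> W. (x, y) \<notin> parcs X} \<le> r - min_degree X"
proof -
  have sub: "pverts X = U \<union> W" "parcs X \<subseteq> U \<times> W \<union> W \<times> U"
    using assms(1) K by (auto simp: edge_subgraph_def spanning_def subgraph_def)
  have "out_arcs (with_proj X) x = Pair x ` {y \<in> W. (x, y) \<in> parcs X}"
    using sub x K(2) by (auto simp: out_arcs_def)
  then have "out_degree (with_proj X) x = card {y \<in> W. (x, y) \<in> parcs X}"
    by (simp add: out_degree_def card_image inj_on_def)
  moreover have "min_degree X \<le> out_degree (with_proj X) x"
    unfolding min_degree_def using sub x fin by (intro Min_le) auto
  moreover have "card {y \<in> W. (x, y) \<in> parcs X} + card {y \<in> W. (x, y) \<notin> parcs X} = r"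
    using card_Collect_split[OF fin(2), of "\<lambda>y. (x, y) \<in> parcs X"] r by simp
  ultimately show "min_degree X \<le> r" "card {y \<in> W. (x, y) \<notin> parcs X} \<le> r - min_degree X"
    by linarith+
qed

theorem theorem1p2:
  fixes r :: nat and K X Y :: "'a pair_pre_digraph"
  assumes "r \<ge> 4"
    and "complete_bipartite_digraph r r (with_proj K)"
    and "edge_subgraph X K" and "edge_subgraph Y K"
    and "min_degree X + min_degree Y \<ge> (3 * r) div 2 + 1"
  shows "card (connected_components (FS X Y)) = 2"
proof -
  obtain A B where AB: "pverts K = A \<union> B" "A \<inter> B = {}" "card A = r" "card B = r"
    "parcs K = A \<times> B \<union> B \<times> A" and "finite (pverts K)"
    using assms(2) unfolding complete_bipartite_digraph_pair_def by blast
  then have fin: "finite A" "finite B" by simp_all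
  have BA: "pverts K = B \<union> A" "B \<inter> A = {}" "parcs K = B \<times> A \<union> A \<times> B" using AB by auto
  have graph: "pair_graph X" "pair_graph Y" using assms(3,4) by (auto simp: edge_subgraph_def)
  have V: "pverts X = A \<union> B" "pverts Y = A \<union> B"
    using assms(3,4) AB by (auto simp: edge_subgraph_def spanning_def)
  let ?X = "\<lambda>x y. (x, y) \<in> parcs X" and ?Y = "\<lambda>x y. (x, y) \<in> parcs Y"
  have cross: "?X x y \<Longrightarrow> cross A B x y" "?Y x y \<Longrightarrow> cross A B x y" for x y
    using assms(3,4) AB by (auto simp: edge_subgraph_def spanning_def subgraph_def cross_def)
  have sym: "symp ?X" "symp ?Y"
    using graph by (simp_all add: symp_parcs)
  note missing = missing_le[OF _ AB(1,2,5) fin AB(3,4)] missing_le[OF _ BA fin(2,1) AB(4,3)]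
  have "A \<noteq> {}" using AB(3) assms(1) by auto
  then obtain a where "a \<in> A" by blast
  then have "min_degree X \<le> r" "min_degree Y \<le> r" using missing(1) assms(3,4) by blast+
  \<comment> \<open>Both degrees are at most r, so the truncated subtractions are exact and the sum
    is at most 2r - floor(3r/2) - 1 = floor((r - 1)/2). An odd r is at least 5, which gives the last
    bound.\<close>
  then have bound: "(r - min_degree X) + (r - min_degree Y) \<le> (r - 1) div 2"
    "2 * ((r - 1) div 2) + 1 \<le> r" "r = 2 * ((r - 1) div 2) + 1 \<Longrightarrow> 2 \<le> (r - 1) div 2"
    using assms(1,5) by linarith+
  have dense: "dense_pair A B A B ?X ?Y (r - min_degree X) (r - min_degree Y) ((r - 1) div 2) r"
    by unfold_locales (use AB fin sym bound missing(2,4) assms(3,4) in auto)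
  interpret bipartition A B by unfold_locales (use AB fin assms(1) in auto)
  \<comment> \<open>A path for the given graphs is also one for the complete ones and so preserves
    the parity; conversely, density realises every path for the complete graphs.\<close>
  have reach_iff: "reach ?X ?Y \<sigma> \<tau> \<longleftrightarrow> (parity \<sigma> \<longleftrightarrow> parity \<tau>)"
    if "\<sigma> permutes A \<union> B" "\<tau> permutes A \<union> B" for \<sigma> \<tau>
    using reach_complete[OF dense cross(1) _ that(1)] reach_mono[of ?X ?Y \<sigma> \<tau> "cross A B" "cross A B"]
      cross reach_iff_parity[OF that] by blast
  have perm: "extend_id (A \<union> B) \<sigma> permutes A \<union> B" if "\<sigma> \<in> pverts (FS X Y)" for \<sigma>
    using that V by (simp add: pverts_FS extend_id_permutes)
  have vert: "restrict p (A \<union> B) \<in> pverts (FS X Y)" if "p permutes A \<union> B" for p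
    using restrict_bij[OF that] V by (simp only: pverts_FS mem_Collect_eq restrict_extensional simp_thms)
  obtain p q where p: "p permutes A \<union> B" "parity p" and q: "q permutes A \<union> B" "\<not> parity q"
    using both_parities by blast
  show ?thesis
  proof (rule card_connected_components_2[OF pair_graph_FS[OF graph] _ vert[OF p(1)] _ vert[OF q(1)]])
    show "\<sigma> \<rightarrow>\<^sup>*\<^bsub>with_proj (FS X Y)\<^esub> \<tau> \<longleftrightarrow>
        (parity (extend_id (A \<union> B) \<sigma>) \<longleftrightarrow> parity (extend_id (A \<union> B) \<tau>))"
      if "\<sigma> \<in> pverts (FS X Y)" "\<tau> \<in> pverts (FS X Y)" for \<sigma> \<tau>
      using reachable_FS_iff[OF V graph that] reach_iff[OF perm[OF that(1)] perm[OF that(2)]] by simp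
    show "parity (extend_id (A \<union> B) (restrict p (A \<union> B)))"
      "\<not> parity (extend_id (A \<union> B) (restrict q (A \<union> B)))"
      using p q by (simp_all add: extend_id_restrict)
  qed
qed

end
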